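(* Let $X$ be a completely regular space and let $H$ be a non-vanishing closed ideal in $C_B(X)$. The following are equivalent: (1) $\mathfrak{sp}(H)$ is totally separated. (2) For every two distinct maximal closed subideals $M$ and $N$ of $H$ there are closed ideals $I$ and $J$ in $C_B(X)$ such that \[I\subseteq M,\quad J\subseteq N\quad\text{and}\quad H=I\oplus J.\] (3) For every two elements $f$ and $g$ of $H$ that are separated in $H$ there are closed ideals $F$ and $G$ in $C_B(X)$ such that \[f\in F,\quad g\in G\quad\text{and}\quad H=F\oplus G.\]
   Context: Completely regular spaces are assumed to be Hausdorff. The scalar field $\mathbb{F}$ is either $\mathbb{R}$ or $\mathbb{C}$ and is fixed. For a space $X$, $C_B(X)$ is the Banach algebra of all bounded continuous mappings $X\to\mathbb{F}$ with pointwise addition and multiplication and the supremum norm. For completely regular $X$, $\beta X$ is the Stone–Čech compactification, and for $f\in C_B(X)$, $f_\beta$ denotes the unique continuous extension of $f$ to $\beta X$. The cozero-set of $f:Y\to\mathbb{F}$ is $\mathrm{Coz}(f)=\{y\in Y: f(y)\neq 0\}$. An ideal $H$ of $C_B(X)$ is non-vanishing if there is no point of $X$ at which every element of $H$ vanishes. For a non-vanishing closed ideal $H$, its spectrum is the subspace $\mathfrak{sp}(H)=\bigcup_{h\in H}\mathrm{Coz}(h_\beta)$ of $\beta X$. A subideal of $H$ is an ideal of $C_B(X)$ contained in $H$; a closed subideal is one that is closed in $C_B(X)$; a maximal closed subideal of $H$ is a closed subideal $M\neq H$ such that the only closed subideals of $H$ containing $M$ are $M$ and $H$. Direct sums are internal.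 For $f\in C_B(X)$ let $\mathrm{Ann}(f)=\{k\in C_B(X): kf=0\}$ and $\mathrm{Stab}(f)=\{k\in C_B(X): kf=f\}$. Elements $g,h$ of $H$ are separated in $H$ if $\mathrm{Ann}(g)\cap\mathrm{Stab}(h)\cap H\neq\emptyset$ and $\mathrm{Ann}(h)\cap\mathrm{Stab}(g)\cap H\neq\emptyset$. A completely regular space $Y$ is totally separated if any two distinct points of $Y$ are separated by (contained respectively in) disjoint open-and-closed subsets of $Y$. *)

theory Defs
  imports "HOL-Analysis.Analysis" "HOL-Algebra.Ideal"
begin

text \<open>
  Spaces are abstract topologies, so that subspaces and the empty space are covered. The underlying
  metric space of $C_B(X)$ is \<^term>\<open>cfunspace X euclidean_metric\<close>: bounded continuous functions on
  \<^term>\<open>topspace X\<close> with the supremum distance, normalised to be \<^term>\<open>undefined\<close> off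
  \<^term>\<open>topspace X\<close>. Therefore the ring operations have to be restricted to \<^term>\<open>topspace X\<close>.
\<close>

definition CB :: "'a topology \<Rightarrow> ('a \<Rightarrow> 'f::real_normed_field) ring" where
  "CB X =
    \<lparr>carrier = mspace (cfunspace X euclidean_metric),
     mult = (\<lambda>f g. \<lambda>x\<in>topspace X. f x * g x),
     one = (\<lambda>x\<in>topspace X. 1),
     zero = (\<lambda>x\<in>topspace X. 0),
     add = (\<lambda>f g. \<lambda>x\<in>topspace X. f x + g x)\<rparr>"

definition closed_ideal :: "'a topology \<Rightarrow> ('a \<Rightarrow> 'f::real_normed_field) set \<Rightarrow> bool" where
  "closed_ideal X I \<longleftrightarrow>
     ideal I (CB X) \<and> closedin (mtopology_of (cfunspace X euclidean_metric)) I"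

definition non_vanishing :: "'a topology \<Rightarrow> ('a \<Rightarrow> 'f::zero) set \<Rightarrow> bool" where
  "non_vanishing X H \<longleftrightarrow> \<not> (\<exists>x\<in>topspace X. \<forall>h\<in>H. h x = 0)"

definition closed_subideal ::
    "'a topology \<Rightarrow> ('a \<Rightarrow> 'f::real_normed_field) set \<Rightarrow> ('a \<Rightarrow> 'f) set \<Rightarrow> bool" where
  "closed_subideal X H I \<longleftrightarrow> closed_ideal X I \<and> I \<subseteq> H"

definition maximal_closed_subideal ::
    "'a topology \<Rightarrow> ('a \<Rightarrow> 'f::real_normed_field) set \<Rightarrow> ('a \<Rightarrow> 'f) set \<Rightarrow> bool" where
  "maximal_closed_subideal X H M \<longleftrightarrow>
     closed_subideal X H M \<and> M \<noteq> H \<and>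
     (\<forall>I. closed_subideal X H I \<and> M \<subseteq> I \<longrightarrow> I = M \<or> I = H)"

definition internal_direct_sum ::
    "('b, 'm) ring_scheme \<Rightarrow> 'b set \<Rightarrow> 'b set \<Rightarrow> 'b set \<Rightarrow> bool" where
  "internal_direct_sum R H I J \<longleftrightarrow> H = I <+>\<^bsub>R\<^esub> J \<and> I \<inter> J = {\<zero>\<^bsub>R\<^esub>}"

definition Ann :: "'a topology \<Rightarrow> ('a \<Rightarrow> 'f::real_normed_field) \<Rightarrow> ('a \<Rightarrow> 'f) set" where
  "Ann X f = {k \<in> carrier (CB X). k \<otimes>\<^bsub>CB X\<^esub> f = \<zero>\<^bsub>CB X\<^esub>}"

definition Stab :: "'a topology \<Rightarrow> ('a \<Rightarrow> 'f::real_normed_field) \<Rightarrow> ('a \<Rightarrow> 'f) set" where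
  "Stab X f = {k \<in> carrier (CB X). k \<otimes>\<^bsub>CB X\<^esub> f = f}"

definition separated_in ::
    "'a topology \<Rightarrow> ('a \<Rightarrow> 'f::real_normed_field) set \<Rightarrow> ('a \<Rightarrow> 'f) \<Rightarrow> ('a \<Rightarrow> 'f) \<Rightarrow> bool" where
  "separated_in X H g h \<longleftrightarrow>
     Ann X g \<inter> Stab X h \<inter> H \<noteq> {} \<and> Ann X h \<inter> Stab X g \<inter> H \<noteq> {}"

text \<open>
  The Stone--Cech compactification, realised as the closure of the image of \<open>X\<close> under evaluation
  in the cube with one factor \<open>[0,1]\<close> for each continuous \<open>X \<rightarrow> [0,1]\<close>; cf.
  \<open>completely_regular_space_cube_embedding_explicit\<close> for the embedding.
\<close>

definition unit_functions :: "'a topology \<Rightarrow> ('a \<Rightarrow> real) set" where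
  "unit_functions X =
     mspace (submetric (cfunspace X euclidean_metric) {f. f \<in> topspace X \<rightarrow> {0..1}})"

definition stone_cech_cube :: "'a topology \<Rightarrow> (('a \<Rightarrow> real) \<Rightarrow> real) topology" where
  "stone_cech_cube X = product_topology (\<lambda>f. top_of_set {0..1}) (unit_functions X)"

definition stone_cech_embed :: "'a topology \<Rightarrow> 'a \<Rightarrow> ('a \<Rightarrow> real) \<Rightarrow> real" where
  "stone_cech_embed X x = (\<lambda>f\<in>unit_functions X. f x)"

definition stone_cech :: "'a topology \<Rightarrow> (('a \<Rightarrow> real) \<Rightarrow> real) topology" where
  "stone_cech X =
     subtopology (stone_cech_cube X)
       (stone_cech_cube X closure_of (stone_cech_embed X ` topspace X))"

definition is_stone_cech_extension ::
    "'a topology \<Rightarrow> ('a \<Rightarrow> 'f::topological_space) \<Rightarrow> ((('a \<Rightarrow> real) \<Rightarrow> real) \<Rightarrow> 'f) \<Rightarrow> bool" where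
  "is_stone_cech_extension X f F \<longleftrightarrow>
     F \<in> extensional (topspace (stone_cech X)) \<and> continuous_map (stone_cech X) euclidean F \<and>
     (\<forall>x\<in>topspace X. F (stone_cech_embed X x) = f x)"

definition stone_cech_extension ::
    "'a topology \<Rightarrow> ('a \<Rightarrow> 'f::topological_space) \<Rightarrow> (('a \<Rightarrow> real) \<Rightarrow> real) \<Rightarrow> 'f" where
  "stone_cech_extension X f = (THE F. is_stone_cech_extension X f F)"

definition Coz :: "'b topology \<Rightarrow> ('b \<Rightarrow> 'f::zero) \<Rightarrow> 'b set" where
  "Coz Y f = {y \<in> topspace Y. f y \<noteq> 0}"

definition spectrum ::
    "'a topology \<Rightarrow> ('a \<Rightarrow> 'f::real_normed_field) set \<Rightarrow> (('a \<Rightarrow> real) \<Rightarrow> real) topology" where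
  "spectrum X H =
     subtopology (stone_cech X) (\<Union>h\<in>H. Coz (stone_cech X) (stone_cech_extension X h))"

definition totally_separated_space :: "'b topology \<Rightarrow> bool" where
  "totally_separated_space Y \<longleftrightarrow>
     completely_regular_space Y \<and> Hausdorff_space Y \<and>
     (\<forall>x\<in>topspace Y. \<forall>y\<in>topspace Y. x \<noteq> y \<longrightarrow>
        (\<exists>U V. openin Y U \<and> closedin Y U \<and> openin Y V \<and> closedin Y V \<and>
               disjnt U V \<and> x \<in> U \<and> y \<in> V))"


subsection \<open>Basic facts about the compactification and the ring\<close>

lemma carrier_CB_iff:
  "f \<in> carrier (CB X) \<longleftrightarrow>
     f \<in> extensional (topspace X) \<and> bounded (f ` topspace X) \<and> continuous_map X euclidean f"
  by (auto simp: CB_def)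

lemma unit_functions_iff:
  "f \<in> unit_functions X \<longleftrightarrow>
     f \<in> extensional (topspace X) \<and> continuous_map X (top_of_set {0..1}) f"
proof -
  have "bounded (f ` topspace X)" if "f \<in> topspace X \<rightarrow> {0..1}"
    using that by (intro bounded_subset[OF bounded_closed_interval[of 0 1]]) auto
  then show ?thesis
    by (auto simp: unit_functions_def continuous_map_in_subtopology)
qed

lemma stone_cech_embed_in:
  "x \<in> topspace X \<Longrightarrow> stone_cech_embed X x \<in> topspace (stone_cech_cube X)"
  by (auto simp: stone_cech_embed_def stone_cech_cube_def unit_functions_def)

lemma stone_cech_embed_image:
  "stone_cech_embed X ` topspace X \<subseteq> topspace (stone_cech X)"
  using closure_of_subset[of "stone_cech_embed X ` topspace X" "stone_cech_cube X"]
    stone_cech_embed_in[of _ X]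
  by (auto simp: stone_cech_def)

lemma stone_cech_embedding:
  assumes "completely_regular_space X" "Hausdorff_space X"
  shows "embedding_map X (stone_cech X) (stone_cech_embed X)"
proof -
  have "embedding_map X (stone_cech_cube X) (stone_cech_embed X)"
    using completely_regular_space_cube_embedding_explicit[OF assms]
    unfolding stone_cech_cube_def stone_cech_embed_def unit_functions_def by simp
  moreover have "stone_cech_embed X ` topspace X \<subseteq>
      stone_cech_cube X closure_of (stone_cech_embed X ` topspace X)"
    using stone_cech_embed_image[of X] by (auto simp: stone_cech_def)
  ultimately show ?thesis
    by (simp add: stone_cech_def embedding_map_in_subtopology)
qed

lemma compact_space_stone_cech: "compact_space (stone_cech X)"
proof -
  have "compact_space (stone_cech_cube X)"
    unfolding stone_cech_cube_def
    by (simp add: compact_space_product_topology compact_space_subtopology)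
  then show ?thesis
    unfolding stone_cech_def
    by (intro compact_space_subtopology closedin_compact_space) auto
qed

lemma Hausdorff_space_stone_cech: "Hausdorff_space (stone_cech X)"
  unfolding stone_cech_def stone_cech_cube_def
  by (intro Hausdorff_space_subtopology)
     (simp add: Hausdorff_space_product_topology Hausdorff_space_subtopology)

lemma stone_cech_dense:
  "stone_cech X closure_of (stone_cech_embed X ` topspace X) = topspace (stone_cech X)"
  using stone_cech_embed_image[of X]
  by (auto simp: stone_cech_def closure_of_subtopology closure_of_subset_topspace Int_absorb1)

lemma stone_cech_extension_real:
  assumes "continuous_map X euclideanreal f" "bounded (f ` topspace X)"
  shows "\<exists>F. continuous_map (stone_cech X) euclideanreal F \<and>
             (\<forall>x\<in>topspace X. F (stone_cech_embed X x) = f x)"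
proof -
  obtain B where B: "B > 0" "\<And>x. x \<in> topspace X \<Longrightarrow> \<bar>f x\<bar> \<le> B"
    using assms(2) unfolding bounded_pos by auto
  define u where "u = (\<lambda>x\<in>topspace X. (f x + B) / (2 * B))"
  have "continuous_map X euclideanreal (\<lambda>x. (f x + B) / (2 * B))"
    using B(1) by (intro continuous_intros assms) auto
  then have "continuous_map X euclideanreal u"
    by (rule continuous_map_eq) (simp add: u_def)
  moreover have "u x \<in> {0..1}" if "x \<in> topspace X" for x
    using B(1) B(2)[OF that] that by (auto simp: u_def field_simps)
  ultimately have u: "u \<in> unit_functions X"
    by (auto simp: unit_functions_iff continuous_map_in_subtopology u_def)
  have "continuous_map (stone_cech_cube X) (top_of_set {0..1}) (\<lambda>p. p u)"
    unfolding stone_cech_cube_def by (rule continuous_map_product_projection[OF u])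
  then have "continuous_map (stone_cech X) euclideanreal (\<lambda>p. p u)"
    unfolding stone_cech_def
    by (intro continuous_map_from_subtopology) (simp add: continuous_map_in_subtopology)
  then have "continuous_map (stone_cech X) euclideanreal (\<lambda>p. 2 * B * p u - B)"
    by (intro continuous_intros) auto
  moreover have "2 * B * stone_cech_embed X x u - B = f x" if "x \<in> topspace X" for x
    using that u B(1) by (simp add: stone_cech_embed_def u_def field_simps)
  ultimately show ?thesis
    by blast
qed

lemma stone_cech_extension_ex1:
  fixes f :: "'a \<Rightarrow> 'f::{euclidean_space,real_normed_field}"
  assumes "f \<in> carrier (CB X)"
  shows "\<exists>!F. is_stone_cech_extension X f F"
proof (rule ex_ex1I)
  have f: "continuous_map X euclidean f" "bounded (f ` topspace X)"
    using assms by (auto simp: carrier_CB_iff)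
  have "\<exists>F. continuous_map (stone_cech X) euclideanreal F \<and>
            (\<forall>x\<in>topspace X. F (stone_cech_embed X x) = f x \<bullet> b)" for b
  proof (rule stone_cech_extension_real)
    have "continuous_map X euclideanreal ((\<lambda>y. y \<bullet> b) \<circ> f)"
      by (rule continuous_map_compose[OF f(1)]) (simp add: continuous_intros)
    then show "continuous_map X euclideanreal (\<lambda>x. f x \<bullet> b)"
      by (simp add: o_def)
    show "bounded ((\<lambda>x. f x \<bullet> b) ` topspace X)"
      using bounded_linear_image[OF f(2) bounded_linear_inner_left] by (simp add: image_image)
  qed
  then obtain E where E: "\<And>b. continuous_map (stone_cech X) euclideanreal (E b)"
    "\<And>b x. x \<in> topspace X \<Longrightarrow> E b (stone_cech_embed X x) = f x \<bullet> b"
    by metis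
  define F where "F = (\<lambda>p\<in>topspace (stone_cech X). \<Sum>b\<in>Basis. E b p *\<^sub>R b)"
  have "continuous_map (stone_cech X) euclidean (\<lambda>p. \<Sum>b\<in>Basis. E b p *\<^sub>R b)"
  proof (rule continuous_map_sum)
    fix b :: 'f
    have "continuous_map (stone_cech X) euclidean ((\<lambda>r. r *\<^sub>R b) \<circ> E b)"
      by (rule continuous_map_compose[OF E(1)]) (simp add: continuous_intros)
    then show "continuous_map (stone_cech X) euclidean (\<lambda>p. E b p *\<^sub>R b)"
      by (simp add: o_def)
  qed simp
  then have "continuous_map (stone_cech X) euclidean F"
    by (rule continuous_map_eq) (simp add: F_def)
  moreover have "F (stone_cech_embed X x) = f x" if "x \<in> topspace X" for x
    using that stone_cech_embed_image[of X] E(2)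
    by (auto simp: F_def euclidean_representation)
  ultimately show "\<exists>F. is_stone_cech_extension X f F"
    unfolding is_stone_cech_extension_def by (intro exI[of _ F]) (auto simp: F_def)
next
  fix F G :: "(('a \<Rightarrow> real) \<Rightarrow> real) \<Rightarrow> 'f"
  assume FG: "is_stone_cech_extension X f F" "is_stone_cech_extension X f G"
  have "F p = G p" if "p \<in> topspace (stone_cech X)" for p
    by (rule forall_in_closure_of_eq[where X = "stone_cech X" and Y = euclidean and f = F and g = G
          and S = "stone_cech_embed X ` topspace X"])
       (use that FG in \<open>auto simp: stone_cech_dense is_stone_cech_extension_def\<close>)
  then show "F = G"
    using FG by (auto simp: is_stone_cech_extension_def intro: extensionalityI)
qed

lemma continuous_map_mult_field:
  fixes f g :: "'a \<Rightarrow> 'f::real_normed_field"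
  shows "continuous_map X euclidean f \<Longrightarrow> continuous_map X euclidean g \<Longrightarrow>
    continuous_map X euclidean (\<lambda>x. f x * g x)"
  by (simp add: continuous_map_atin tendsto_mult)

lemma bounded_mult_field:
  fixes f g :: "'a \<Rightarrow> 'f::real_normed_field"
  assumes "bounded (f ` S)" "bounded (g ` S)"
  shows "bounded ((\<lambda>x. f x * g x) ` S)"
proof -
  obtain a b where "\<And>x. x \<in> S \<Longrightarrow> norm (f x) \<le> a" "\<And>x. x \<in> S \<Longrightarrow> norm (g x) \<le> b"
    using assms by (auto simp: bounded_iff)
  then have "norm (f x * g x) \<le> a * b" if "x \<in> S" for x
    using that norm_ge_zero[of "f x"]
    by (auto simp: norm_mult intro!: mult_mono intro: order_trans[of 0 "norm (f x)"])
  then show ?thesis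
    by (auto simp: bounded_iff)
qed

lemma restrict_in_carrier_CB:
  fixes f :: "'a \<Rightarrow> 'f::real_normed_field"
  assumes "continuous_map X euclidean f" "bounded (f ` topspace X)"
  shows "(\<lambda>x\<in>topspace X. f x) \<in> carrier (CB X)"
  using assms continuous_map_eq[OF assms(1), of "restrict f (topspace X)"]
  by (simp add: carrier_CB_iff)

lemma cring_CB: "cring (CB X :: ('a \<Rightarrow> 'f::real_normed_field) ring)"
proof (rule cringI)
  show "abelian_group (CB X :: ('a \<Rightarrow> 'f) ring)"
  proof (rule abelian_groupI)
    fix f g :: "'a \<Rightarrow> 'f"
    assume "f \<in> carrier (CB X)" "g \<in> carrier (CB X)"
    then show "f \<oplus>\<^bsub>CB X\<^esub> g \<in> carrier (CB X)"
      using restrict_in_carrier_CB[OF continuous_map_add bounded_plus_comp, of X f g]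
      by (simp add: carrier_CB_iff) (simp add: CB_def)
  next
    show "\<zero>\<^bsub>CB X\<^esub> \<in> (carrier (CB X) :: ('a \<Rightarrow> 'f) set)"
      using restrict_in_carrier_CB[of X "\<lambda>x. 0"] by (simp add: CB_def image_constant_conv)
  next
    fix f :: "'a \<Rightarrow> 'f"
    assume f: "f \<in> carrier (CB X)"
    have "bounded ((\<lambda>x. - f x) ` topspace X)"
      using f bounded_uminus[of "f ` topspace X"] by (simp add: carrier_CB_iff image_image)
    then have "(\<lambda>x\<in>topspace X. - f x) \<in> carrier (CB X)"
      using f by (intro restrict_in_carrier_CB) (auto simp: carrier_CB_iff)
    moreover have "(\<lambda>x\<in>topspace X. - f x) \<oplus>\<^bsub>CB X\<^esub> f = \<zero>\<^bsub>CB X\<^esub>"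
      by (auto simp: CB_def restrict_def)
    ultimately show "\<exists>g\<in>carrier (CB X). g \<oplus>\<^bsub>CB X\<^esub> f = \<zero>\<^bsub>CB X\<^esub>"
      by blast
  qed (auto simp: CB_def restrict_def algebra_simps extensional_def)
  show "Group.comm_monoid (CB X :: ('a \<Rightarrow> 'f) ring)"
  proof (rule comm_monoidI)
    fix f g :: "'a \<Rightarrow> 'f"
    assume "f \<in> carrier (CB X)" "g \<in> carrier (CB X)"
    then show "f \<otimes>\<^bsub>CB X\<^esub> g \<in> carrier (CB X)"
      using restrict_in_carrier_CB[OF continuous_map_mult_field bounded_mult_field, of X f g]
      by (simp add: carrier_CB_iff) (simp add: CB_def)
  next
    show "\<one>\<^bsub>CB X\<^esub> \<in> (carrier (CB X) :: ('a \<Rightarrow> 'f) set)"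
      using restrict_in_carrier_CB[of X "\<lambda>x. 1"] by (simp add: CB_def image_constant_conv)
  qed (auto simp: CB_def restrict_def algebra_simps extensional_def)
qed (auto simp: CB_def restrict_def algebra_simps)

end

theory Submission
  imports Defs
begin

text \<open>
  Write \<open>K\<close> for the Stone--Cech compactification of \<open>X\<close>. Extension to \<open>K\<close> identifies the ring of
  bounded continuous functions on \<open>X\<close> with the ring of all continuous functions on the compact
  Hausdorff space \<open>K\<close>, isometrically. In such a ring a closed ideal is determined by the open set of
  points where some member does not vanish: an ideal \<open>I\<close> corresponds to its spectrum, and an open set
  \<open>W\<close> to the functions vanishing off \<open>W\<close> (\<open>closed_ideal_eq_carried_by\<close>, \<open>spec_carried_by\<close>). This
  correspondence preserves inclusion, so each algebraic condition in the theorem turns into a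
  condition on open subsets of \<open>S\<close>, the spectrum of \<open>H\<close>.

  \<^item> \<open>H\<close> is the direct sum of \<open>I\<close> and \<open>J\<close> exactly if the spectra of \<open>I\<close> and \<open>J\<close> partition \<open>S\<close>
    (\<open>internal_direct_sum_iff_spec\<close>), that is, if they are complementary clopen subsets of \<open>S\<close>.
  \<^item> The maximal closed subideals of \<open>H\<close> correspond to the sets \<open>S - {x}\<close> with \<open>x \<in> S\<close>
    (\<open>maximal_closed_subideal_iff\<close>).
  \<^item> If \<open>f\<close> and \<open>g\<close> are separated in \<open>H\<close>, they vanish outside two disjoint compact subsets of \<open>S\<close>
    (\<open>separated_in_closed_supports\<close>); conversely, any two points of \<open>S\<close> carry separated functions
    that are nonzero there (\<open>separated_in_at_points\<close>).

  The condition on maximal closed subideals therefore says literally that any two points of \<open>S\<close> lie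
  in different parts of a clopen partition of \<open>S\<close>, which is total separation. The condition on
  separated elements follows from total separation because clopen sets that separate points can be
  combined, by compactness, to separate disjoint compact sets (\<open>totally_separated_compact_sets\<close>); it
  implies total separation when applied to separated functions at two given points.

  The argument is uniform in the scalars: everything is proved for a normed field that is also a
  Euclidean space, which covers the real and the complex numbers at once.
\<close>

abbreviation ext :: "'a topology \<Rightarrow> ('a \<Rightarrow> 'f::{euclidean_space,real_normed_field}) \<Rightarrow>
    (('a \<Rightarrow> real) \<Rightarrow> real) \<Rightarrow> 'f" where
  "ext \<equiv> stone_cech_extension"

abbreviation spec :: "'a topology \<Rightarrow> ('a \<Rightarrow> 'f::{euclidean_space,real_normed_field}) set \<Rightarrow>
    (('a \<Rightarrow> real) \<Rightarrow> real) set" where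
  "spec X I \<equiv> topspace (spectrum X I)"

section \<open>Bounded functions as functions on the compactification\<close>

lemma ext_is_extension:
  assumes "f \<in> carrier (CB X)"
  shows "is_stone_cech_extension X f (ext X f)"
  unfolding stone_cech_extension_def by (rule theI'[OF stone_cech_extension_ex1[OF assms]])

lemma continuous_map_ext:
  assumes "f \<in> carrier (CB X)"
  shows "continuous_map (stone_cech X) euclidean (ext X f)"
  using ext_is_extension[OF assms] by (simp add: is_stone_cech_extension_def)

lemma ext_embed:
  assumes "f \<in> carrier (CB X)" "x \<in> topspace X"
  shows "ext X f (stone_cech_embed X x) = f x"
  using ext_is_extension[OF assms(1)] assms(2) by (simp add: is_stone_cech_extension_def)

lemma stone_cech_embed_in_stone_cech:
  "x \<in> topspace X \<Longrightarrow> stone_cech_embed X x \<in> topspace (stone_cech X)"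
  by (rule subsetD[OF stone_cech_embed_image imageI])

lemma ext_unique:
  assumes "f \<in> carrier (CB X)" "continuous_map (stone_cech X) euclidean F"
    and "\<And>x. x \<in> topspace X \<Longrightarrow> F (stone_cech_embed X x) = f x"
    and "p \<in> topspace (stone_cech X)"
  shows "ext X f p = F p"
  by (rule forall_in_closure_of_eq[where X = "stone_cech X" and Y = euclidean
        and f = "ext X f" and g = F and S = "stone_cech_embed X ` topspace X"])
     (use assms in \<open>auto simp: stone_cech_dense continuous_map_ext ext_embed\<close>)

lemma CB_ops:
  "f \<oplus>\<^bsub>CB X\<^esub> g = (\<lambda>x\<in>topspace X. f x + g x)" "f \<otimes>\<^bsub>CB X\<^esub> g = (\<lambda>x\<in>topspace X. f x * g x)"
  "\<zero>\<^bsub>CB X\<^esub> = (\<lambda>x\<in>topspace X. 0)"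
  by (simp_all add: CB_def)

lemma CB_closed:
  fixes f g :: "'a \<Rightarrow> 'f::real_normed_field"
  shows "\<zero>\<^bsub>CB X\<^esub> \<in> (carrier (CB X) :: ('a \<Rightarrow> 'f) set)"
    and "f \<in> carrier (CB X) \<Longrightarrow> g \<in> carrier (CB X) \<Longrightarrow> f \<oplus>\<^bsub>CB X\<^esub> g \<in> carrier (CB X)"
    and "f \<in> carrier (CB X) \<Longrightarrow> g \<in> carrier (CB X) \<Longrightarrow> f \<otimes>\<^bsub>CB X\<^esub> g \<in> carrier (CB X)"
proof -
  interpret cring "CB X :: ('a \<Rightarrow> 'f) ring" by (rule cring_CB)
  show "\<zero>\<^bsub>CB X\<^esub> \<in> (carrier (CB X) :: ('a \<Rightarrow> 'f) set)" by simp
  show "f \<in> carrier (CB X) \<Longrightarrow> g \<in> carrier (CB X) \<Longrightarrow> f \<oplus>\<^bsub>CB X\<^esub> g \<in> carrier (CB X)" by simp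
  show "f \<in> carrier (CB X) \<Longrightarrow> g \<in> carrier (CB X) \<Longrightarrow> f \<otimes>\<^bsub>CB X\<^esub> g \<in> carrier (CB X)" by simp
qed

lemma ext_zero:
  "p \<in> topspace (stone_cech X) \<Longrightarrow> ext X \<zero>\<^bsub>CB X\<^esub> p = 0"
  by (rule ext_unique[of _ X "\<lambda>_. 0"]) (simp_all add: CB_closed, simp add: CB_ops)

lemma ext_add:
  assumes "f \<in> carrier (CB X)" "g \<in> carrier (CB X)" "p \<in> topspace (stone_cech X)"
  shows "ext X (f \<oplus>\<^bsub>CB X\<^esub> g) p = ext X f p + ext X g p"
proof (rule ext_unique[of _ X "\<lambda>p. ext X f p + ext X g p"])
  show "continuous_map (stone_cech X) euclidean (\<lambda>p. ext X f p + ext X g p)"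
    by (intro continuous_map_add continuous_map_ext assms)
qed (use assms in \<open>simp_all add: CB_closed ext_embed\<close>, simp add: CB_ops)

lemma ext_mult:
  assumes "f \<in> carrier (CB X)" "g \<in> carrier (CB X)" "p \<in> topspace (stone_cech X)"
  shows "ext X (f \<otimes>\<^bsub>CB X\<^esub> g) p = ext X f p * ext X g p"
proof (rule ext_unique[of _ X "\<lambda>p. ext X f p * ext X g p"])
  show "continuous_map (stone_cech X) euclidean (\<lambda>p. ext X f p * ext X g p)"
    by (intro continuous_map_mult_field continuous_map_ext assms)
qed (use assms in \<open>simp_all add: CB_closed ext_embed\<close>, simp add: CB_ops)

lemma ext_inject:
  assumes "f \<in> carrier (CB X)" "g \<in> carrier (CB X)"
    and "\<And>p. p \<in> topspace (stone_cech X) \<Longrightarrow> ext X f p = ext X g p"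
  shows "f = g"
proof (rule extensionalityI[of _ "topspace X"])
  show "f x = g x" if "x \<in> topspace X" for x
  proof -
    have "stone_cech_embed X x \<in> topspace (stone_cech X)"
      using that by (rule stone_cech_embed_in_stone_cech)
    then show ?thesis
      using assms(3) ext_embed[OF assms(1) that] ext_embed[OF assms(2) that] by simp
  qed
qed (use assms(1,2) in \<open>auto simp: carrier_CB_iff\<close>)

lemma continuous_map_stone_cech_embed:
  "continuous_map X (stone_cech X) (stone_cech_embed X)"
proof -
  have "continuous_map X (stone_cech_cube X) (stone_cech_embed X)"
    unfolding stone_cech_cube_def continuous_map_componentwise
    by (auto simp: stone_cech_embed_def unit_functions_iff elim: continuous_map_eq)
  moreover have "stone_cech_embed X \<in> topspace X \<rightarrow>
      stone_cech_cube X closure_of (stone_cech_embed X ` topspace X)"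
    using stone_cech_embed_image[of X] by (auto simp: stone_cech_def)
  ultimately show ?thesis
    by (simp add: stone_cech_def continuous_map_in_subtopology)
qed

text \<open>
  Every continuous function on \<open>K\<close> is bounded by compactness and is the extension of its pullback
  along the embedding. This is how members of the ring are constructed below: it suffices to give a
  continuous function on \<open>K\<close>.
\<close>
lemma ext_surj:
  fixes F :: "(('a \<Rightarrow> real) \<Rightarrow> real) \<Rightarrow> 'f::{euclidean_space,real_normed_field}"
  assumes F: "continuous_map (stone_cech X) euclidean F"
  obtains f where "f \<in> carrier (CB X)" "\<And>p. p \<in> topspace (stone_cech X) \<Longrightarrow> ext X f p = F p"
proof -
  define f where "f = (\<lambda>x\<in>topspace X. (F \<circ> stone_cech_embed X) x)"
  have "compactin euclidean (F ` topspace (stone_cech X))"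
    using compact_space_stone_cech F unfolding compact_space_def by (rule image_compactin)
  then have "bounded (F ` topspace (stone_cech X))"
    by (simp add: compact_imp_bounded)
  then have "bounded ((F \<circ> stone_cech_embed X) ` topspace X)"
    by (rule bounded_subset) (auto intro: stone_cech_embed_in_stone_cech)
  then have f: "f \<in> carrier (CB X)"
    unfolding f_def
    by (intro restrict_in_carrier_CB continuous_map_compose[OF continuous_map_stone_cech_embed F])
  then have "ext X f p = F p" if "p \<in> topspace (stone_cech X)" for p
    by (rule ext_unique) (use F that in \<open>auto simp: f_def\<close>)
  with f show ?thesis
    by (rule that)
qed

text \<open>
  A uniform bound passes from the dense image of \<open>X\<close> to \<open>K\<close>; thus extension is an isometry, and
  uniform limits may be taken on either space.
\<close>
lemma ext_dist_le:
  assumes "f \<in> carrier (CB X)" "g \<in> carrier (CB X)"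
    and "\<And>x. x \<in> topspace X \<Longrightarrow> dist (f x) (g x) \<le> r"
    and "p \<in> topspace (stone_cech X)"
  shows "dist (ext X f p) (ext X g p) \<le> r"
proof (rule forall_in_closure_of[where X = "stone_cech X" and S = "stone_cech_embed X ` topspace X"
      and P = "\<lambda>p. dist (ext X f p) (ext X g p) \<le> r"])
  have "continuous_map (stone_cech X) euclideanreal (\<lambda>p. norm (ext X f p - ext X g p))"
    by (intro continuous_map_norm continuous_map_diff continuous_map_ext assms)
  from closedin_continuous_map_preimage[OF this, of "{..r}"]
  show "closedin (stone_cech X) {p \<in> topspace (stone_cech X). dist (ext X f p) (ext X g p) \<le> r}"
    by (simp add: dist_norm)
qed (use assms in \<open>auto simp: stone_cech_dense ext_embed\<close>)

section \<open>Closed ideals and open sets\<close>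

text \<open>
  The metric of the function space is replaced by pointwise bounds here and in the next lemma, so
  that later arguments need neither suprema nor balls.
\<close>
lemma closed_ideal_limit:
  assumes I: "closed_ideal X I" and f: "f \<in> carrier (CB X)"
    and approx: "\<And>e. e > 0 \<Longrightarrow> \<exists>g\<in>I. \<forall>x\<in>topspace X. dist (f x) (g x) \<le> e"
  shows "f \<in> I"
proof (rule ccontr)
  assume "f \<notin> I"
  let ?m = "cfunspace X euclidean_metric :: ('a \<Rightarrow> 'b) metric"
  interpret Metric_space "mspace ?m" "mdist ?m" by (rule Metric_space_mspace_mdist)
  have "closedin mtopology I"
    using I by (simp add: closed_ideal_def mtopology_of_def)
  moreover have f': "f \<in> mspace ?m"
    using f unfolding CB_def by simp
  ultimately obtain r where "r > 0" and r: "disjnt I (mball f r)" and sub: "I \<subseteq> mspace ?m"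
    using \<open>f \<notin> I\<close> unfolding closedin_metric by blast
  obtain g where g: "g \<in> I" "\<forall>x\<in>topspace X. dist (f x) (g x) \<le> r / 2"
    using approx[of "r / 2"] \<open>r > 0\<close> by auto
  have "mdist ?m f g \<le> r / 2"
    using g(2) \<open>r > 0\<close> by (intro mdist_cfunspace_le) auto
  then have "g \<in> mball f r"
    using g(1) sub f' \<open>r > 0\<close> by (auto simp del: mspace_cfunspace simp: in_mball)
  with g(1) r show False
    by (auto simp: disjnt_iff)
qed

lemma closed_idealI:
  fixes I :: "('a \<Rightarrow> 'f::real_normed_field) set"
  assumes sub: "I \<subseteq> carrier (CB X)" and zero: "\<zero>\<^bsub>CB X\<^esub> \<in> I"
    and add: "\<And>f g. f \<in> I \<Longrightarrow> g \<in> I \<Longrightarrow> f \<oplus>\<^bsub>CB X\<^esub> g \<in> I"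
    and mult: "\<And>f g. f \<in> carrier (CB X) \<Longrightarrow> g \<in> I \<Longrightarrow> f \<otimes>\<^bsub>CB X\<^esub> g \<in> I"
    and lim: "\<And>f. f \<in> carrier (CB X) \<Longrightarrow>
      (\<And>e. e > 0 \<Longrightarrow> \<exists>g\<in>I. \<forall>x\<in>topspace X. dist (f x) (g x) \<le> e) \<Longrightarrow> f \<in> I"
  shows "closed_ideal X I"
  unfolding closed_ideal_def
proof
  interpret cring "CB X :: ('a \<Rightarrow> 'f) ring" by (rule cring_CB)
  show "ideal I (CB X)"
  proof (rule idealI)
    show "subgroup I (add_monoid (CB X))"
    proof (rule add.subgroupI)
      show "\<ominus>\<^bsub>CB X\<^esub> f \<in> I" if "f \<in> I" for f
      proof -
        have "\<ominus>\<^bsub>CB X\<^esub> f = (\<ominus>\<^bsub>CB X\<^esub> \<one>\<^bsub>CB X\<^esub>) \<otimes>\<^bsub>CB X\<^esub> f"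
          using that sub by (simp add: l_minus subset_eq)
        then show ?thesis
          using that mult[of "\<ominus>\<^bsub>CB X\<^esub> \<one>\<^bsub>CB X\<^esub>" f] by simp
      qed
    qed (use sub zero add in auto)
    show "f \<otimes>\<^bsub>CB X\<^esub> g \<in> I" if "f \<in> I" "g \<in> carrier (CB X)" for f g
      using mult[of g f] that sub m_comm by auto
  qed (use mult in \<open>auto intro: ring_axioms\<close>)
  let ?m = "cfunspace X euclidean_metric :: ('a \<Rightarrow> 'f) metric"
  interpret Metric_space "mspace ?m" "mdist ?m" by (rule Metric_space_mspace_mdist)
  have carrier: "carrier (CB X) = mspace ?m"
    by (simp add: CB_def)
  have "closedin mtopology I"
    unfolding closedin_metric
  proof (intro conjI allI impI)
    show "I \<subseteq> mspace ?m"
      using sub by (simp add: carrier del: mspace_cfunspace)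
    fix f assume f: "f \<in> mspace ?m - I"
    then obtain e where "e > 0" and e: "\<not> (\<exists>g\<in>I. \<forall>x\<in>topspace X. dist (f x) (g x) \<le> e)"
      using lim[of f] carrier by blast
    have "g \<notin> mball f e" if "g \<in> I" for g
    proof
      assume "g \<in> mball f e"
      then have "f \<in> mspace ?m" "g \<in> mspace ?m" "mdist ?m f g \<le> e"
        by (auto simp del: mspace_cfunspace simp: in_mball)
      then have "\<forall>x\<in>topspace X. dist (f x) (g x) \<le> e"
        using cfunspace_mdist_le[of f X euclidean_metric g e]
        by (cases "X = trivial_topology") auto
      with e that show False by blast
    qed
    with \<open>e > 0\<close> show "\<exists>r>0. disjnt I (mball f r)"
      by (auto simp: disjnt_iff)
  qed
  then show "closedin (mtopology_of ?m) I"
    by (simp add: mtopology_of_def)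
qed

lemma closed_idealD:
  assumes "closed_ideal X I"
  shows "I \<subseteq> carrier (CB X)" "\<zero>\<^bsub>CB X\<^esub> \<in> I"
    and "\<And>f g. f \<in> I \<Longrightarrow> g \<in> I \<Longrightarrow> f \<oplus>\<^bsub>CB X\<^esub> g \<in> I"
    and "\<And>f g. f \<in> carrier (CB X) \<Longrightarrow> g \<in> I \<Longrightarrow> f \<otimes>\<^bsub>CB X\<^esub> g \<in> I"
    and "\<And>f g. f \<in> I \<Longrightarrow> g \<in> carrier (CB X) \<Longrightarrow> f \<otimes>\<^bsub>CB X\<^esub> g \<in> I"
proof -
  interpret ideal I "CB X" using assms by (simp add: closed_ideal_def)
  show "I \<subseteq> carrier (CB X)" "\<zero>\<^bsub>CB X\<^esub> \<in> I"
    and "\<And>f g. f \<in> I \<Longrightarrow> g \<in> I \<Longrightarrow> f \<oplus>\<^bsub>CB X\<^esub> g \<in> I"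
    and "\<And>f g. f \<in> carrier (CB X) \<Longrightarrow> g \<in> I \<Longrightarrow> f \<otimes>\<^bsub>CB X\<^esub> g \<in> I"
    and "\<And>f g. f \<in> I \<Longrightarrow> g \<in> carrier (CB X) \<Longrightarrow> f \<otimes>\<^bsub>CB X\<^esub> g \<in> I"
    by (auto intro: I_l_closed I_r_closed a_subset[THEN subsetD])
qed

text \<open>
  This set is the candidate for the inverse of the passage from a closed ideal to its spectrum. It
  is a closed ideal for an arbitrary set \<open>W\<close>, but only an open \<open>W\<close> can be recovered from it.
\<close>
definition carried_by :: "'a topology \<Rightarrow> (('a \<Rightarrow> real) \<Rightarrow> real) set \<Rightarrow>
    ('a \<Rightarrow> 'f::{euclidean_space,real_normed_field}) set" where
  "carried_by X W = {f \<in> carrier (CB X). \<forall>p\<in>topspace (stone_cech X) - W. ext X f p = 0}"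

lemma closed_ideal_carried_by: "closed_ideal X (carried_by X W)"
proof (rule closed_idealI)
  fix f :: "'a \<Rightarrow> 'b"
  assume f: "f \<in> carrier (CB X)"
    and lim: "\<And>e. e > 0 \<Longrightarrow> \<exists>g\<in>carried_by X W. \<forall>x\<in>topspace X. dist (f x) (g x) \<le> e"
  have "ext X f p = 0" if p: "p \<in> topspace (stone_cech X) - W" for p
  proof -
    have "norm (ext X f p) \<le> e" if e: "e > 0" for e
    proof -
      obtain g where "g \<in> carried_by X W" "\<forall>x\<in>topspace X. dist (f x) (g x) \<le> e"
        using lim[OF e] by blast
      then show ?thesis
        using ext_dist_le[of f X g e p] f p by (simp add: carried_by_def)
    qed
    then show ?thesis
      using field_le_epsilon[of "norm (ext X f p)" 0] by auto
  qed
  with f show "f \<in> carried_by X W"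
    by (simp add: carried_by_def)
qed (auto simp: carried_by_def CB_closed ext_zero ext_add ext_mult)

lemma mem_spec_iff:
  "p \<in> spec X I \<longleftrightarrow> p \<in> topspace (stone_cech X) \<and> (\<exists>h\<in>I. ext X h p \<noteq> 0)"
  by (auto simp: spectrum_def Coz_def)

lemma spec_mono: "I \<subseteq> J \<Longrightarrow> spec X I \<subseteq> spec X J"
proof
  fix p assume "I \<subseteq> J" "p \<in> spec X I"
  then obtain h where "p \<in> topspace (stone_cech X)" "h \<in> J" "ext X h p \<noteq> 0"
    by (auto simp: mem_spec_iff)
  then show "p \<in> spec X J"
    unfolding mem_spec_iff by blast
qed

lemma openin_nonzero:
  assumes "f \<in> carrier (CB X)"
  shows "openin (stone_cech X) {p \<in> topspace (stone_cech X). ext X f p \<noteq> 0}"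
  using openin_continuous_map_preimage[OF continuous_map_ext[OF assms], of "- {0}"] by (simp add: open_Compl)

lemma openin_spec:
  assumes "I \<subseteq> carrier (CB X)"
  shows "openin (stone_cech X) (spec X I)"
proof -
  have "spec X I = (\<Union>h\<in>I. {p \<in> topspace (stone_cech X). ext X h p \<noteq> 0})"
    by (auto simp: mem_spec_iff)
  then show ?thesis
    using openin_nonzero[OF subsetD[OF assms]] by auto
qed

lemma spectrum_eq: "spectrum X I = subtopology (stone_cech X) (spec X I)"
  by (simp add: spectrum_def subtopology_restrict Coz_def Int_absorb1 flip: subtopology_subtopology)

lemma compactin_spectrum:
  assumes "closedin (stone_cech X) C" "C \<subseteq> spec X H"
  shows "compactin (spectrum X H) C"
proof -
  have "compactin (stone_cech X) C"
    by (rule closedin_compact_space[OF compact_space_stone_cech assms(1)])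
  then have "compactin (subtopology (stone_cech X) (spec X H)) C"
    using assms(2) by (simp add: compactin_subtopology)
  then show ?thesis
    by (subst spectrum_eq)
qed

text \<open>
  Compactness in the form used below: if an open cover is closed under finite unions, one of its
  members already contains the compact set.
\<close>
lemma compactin_subset_directed_cover:
  assumes C: "compactin X C" and "{} \<in> \<U>" "\<And>U V. U \<in> \<U> \<Longrightarrow> V \<in> \<U> \<Longrightarrow> U \<union> V \<in> \<U>"
    and cover: "\<And>c. c \<in> C \<Longrightarrow> \<exists>U\<in>\<U>. c \<in> U" and op: "\<And>U. U \<in> \<U> \<Longrightarrow> openin X U"
  obtains U where "U \<in> \<U>" "C \<subseteq> U"
proof -
  have "C \<subseteq> \<Union>\<U>"
    using cover by blast
  then obtain \<F> where "finite \<F>" "\<F> \<subseteq> \<U>" "C \<subseteq> \<Union>\<F>"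
    using C op unfolding compactin_def by blast
  moreover have "\<Union>\<F> \<in> \<U>"
    using \<open>finite \<F>\<close> \<open>\<F> \<subseteq> \<U>\<close> by (induction \<F>) (auto intro: assms)
  ultimately show ?thesis
    by (intro that)
qed

text \<open>
  Complex conjugation, written through the norm so that it makes sense over the real and the complex
  numbers alike. Its role is to turn a member \<open>k\<close> of an ideal into the nonnegative member
  \<open>|k|\<^sup>2\<close>, with the same zeros. At \<open>z = 0\<close> the formula has the right value because \<open>0 / 0 = 0\<close>.
\<close>
definition cnj_field :: "'f::real_normed_field \<Rightarrow> 'f" where
  "cnj_field z = of_real ((norm z)\<^sup>2) / z"

lemma norm_cnj_field: "norm (cnj_field z) = norm z"
  by (simp add: cnj_field_def norm_divide norm_mult power2_eq_square)

lemma mult_cnj_field: "z * cnj_field z = of_real ((norm z)\<^sup>2)"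
  by (simp add: cnj_field_def)

lemma isCont_cnj_field: "isCont cnj_field (z :: 'f::real_normed_field)"
proof (cases "z = 0")
  case True
  have "((\<lambda>w::'f. norm (cnj_field w)) \<longlongrightarrow> 0) (at 0)"
    using tendsto_norm_zero[OF tendsto_ident_at[of "0::'f"]] by (simp add: norm_cnj_field)
  then have "(cnj_field \<longlongrightarrow> (0::'f)) (at 0)"
    by (rule tendsto_norm_zero_cancel)
  then show ?thesis
    using True by (simp add: isCont_def) (simp add: cnj_field_def)
next
  case False
  then show ?thesis
    unfolding cnj_field_def by (intro continuous_intros)
qed

lemma continuous_map_cnj_field:
  fixes f :: "'a \<Rightarrow> 'f::real_normed_field"
  assumes "continuous_map X euclidean f"
  shows "continuous_map X euclidean (\<lambda>x. cnj_field (f x))"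
  using continuous_map_compose[OF assms, of euclidean cnj_field]
  by (simp add: o_def continuous_on_eq_continuous_at isCont_cnj_field)

lemma continuous_map_of_real_comp:
  assumes "continuous_map X euclideanreal f"
  shows "continuous_map X euclidean (\<lambda>x. of_real (f x) :: 'f::real_normed_field)"
  using continuous_map_compose[OF assms, of euclidean "of_real :: real \<Rightarrow> 'f"]
  by (simp add: o_def continuous_on_of_real)

text \<open>
  The witness extends to \<open>|f|\<^sup>2 + |g|\<^sup>2\<close>. Hence the cozero sets of the members of an ideal are
  closed under finite unions, as the directed form of compactness requires.
\<close>
lemma closed_ideal_nonzero_Un:
  assumes I: "closed_ideal X I" and "f \<in> I" "g \<in> I"
  obtains k where "k \<in> I"
    "\<And>p. p \<in> topspace (stone_cech X) \<Longrightarrow> ext X k p \<noteq> 0 \<longleftrightarrow> ext X f p \<noteq> 0 \<or> ext X g p \<noteq> 0"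
proof -
  have fg: "f \<in> carrier (CB X)" "g \<in> carrier (CB X)"
    using closed_idealD(1)[OF I] assms(2,3) by auto
  obtain f' where f': "f' \<in> carrier (CB X)"
    "\<And>p. p \<in> topspace (stone_cech X) \<Longrightarrow> ext X f' p = cnj_field (ext X f p)"
    using ext_surj[OF continuous_map_cnj_field[OF continuous_map_ext[OF fg(1)]]] by metis
  obtain g' where g': "g' \<in> carrier (CB X)"
    "\<And>p. p \<in> topspace (stone_cech X) \<Longrightarrow> ext X g' p = cnj_field (ext X g p)"
    using ext_surj[OF continuous_map_cnj_field[OF continuous_map_ext[OF fg(2)]]] by metis
  show ?thesis
  proof
    show "f \<otimes>\<^bsub>CB X\<^esub> f' \<oplus>\<^bsub>CB X\<^esub> g \<otimes>\<^bsub>CB X\<^esub> g' \<in> I"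
      using assms f' g' by (intro closed_idealD[OF I])
    fix p assume p: "p \<in> topspace (stone_cech X)"
    have "ext X (f \<otimes>\<^bsub>CB X\<^esub> f' \<oplus>\<^bsub>CB X\<^esub> g \<otimes>\<^bsub>CB X\<^esub> g') p =
        of_real ((norm (ext X f p))\<^sup>2 + (norm (ext X g p))\<^sup>2)"
      using p fg f' g' by (simp add: ext_add ext_mult CB_closed mult_cnj_field)
    then show "ext X (f \<otimes>\<^bsub>CB X\<^esub> f' \<oplus>\<^bsub>CB X\<^esub> g \<otimes>\<^bsub>CB X\<^esub> g') p \<noteq> 0 \<longleftrightarrow>
        ext X f p \<noteq> 0 \<or> ext X g p \<noteq> 0"
      by (simp only: of_real_eq_0_iff sum_power2_eq_zero_iff) simp
  qed
qed

text \<open>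
  A function \<open>h\<close> that vanishes wherever all of \<open>I\<close> vanishes is a uniform limit of members of \<open>I\<close>: for
  \<open>e > 0\<close> the set where \<open>|h| \<ge> e\<close> is compact and covered by cozero sets of members of \<open>I\<close>, hence
  contained in the cozero set of a single \<open>k \<in> I\<close>. From \<open>k\<close> one builds a multiple \<open>t\<close> of \<open>k\<close> with
  values in \<open>[0,1]\<close> that equals \<open>1\<close> on that set. Then \<open>h t\<close> lies in \<open>I\<close> and differs from \<open>h\<close> only
  where \<open>|h| < e\<close>, by at most \<open>e\<close>.
\<close>
theorem closed_ideal_eq_carried_by:
  fixes I :: "('a \<Rightarrow> 'f::{euclidean_space,real_normed_field}) set"
  assumes I: "closed_ideal X I"
  shows "carried_by X (spec X I) = I"
proof
  show "I \<subseteq> carried_by X (spec X I)"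
    using closed_idealD(1)[OF I] by (auto simp: carried_by_def mem_spec_iff)
next
  show "carried_by X (spec X I) \<subseteq> I"
  proof
    fix h :: "'a \<Rightarrow> 'f" assume "h \<in> carried_by X (spec X I)"
    then have h: "h \<in> carrier (CB X)"
      and h0: "\<And>p. p \<in> topspace (stone_cech X) \<Longrightarrow> ext X h p \<noteq> 0 \<Longrightarrow> p \<in> spec X I"
      by (auto simp: carried_by_def)
    note hcont = continuous_map_ext[OF h]
    show "h \<in> I"
    proof (rule closed_ideal_limit[OF I h])
      fix e :: real
      assume "e > 0"
      define A where "A = {p \<in> topspace (stone_cech X). norm (ext X h p) \<in> {e..}}"
      have "closedin (stone_cech X) A"
        unfolding A_def
        by (intro closedin_continuous_map_preimage[OF continuous_map_norm[OF hcont]]) auto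
      then have A: "compactin (stone_cech X) A"
        using compact_space_stone_cech closedin_compact_space by blast
      let ?nz = "\<lambda>k. {p \<in> topspace (stone_cech X). ext X k p \<noteq> 0}"
      obtain U where "U \<in> ?nz ` I" "A \<subseteq> U"
      proof (rule compactin_subset_directed_cover[OF A, of "?nz ` I"])
        show "{} \<in> ?nz ` I"
          using closed_idealD(2)[OF I] ext_zero[where X = X] by (intro image_eqI) auto
        show "openin (stone_cech X) U" if "U \<in> ?nz ` I" for U
          using that closed_idealD(1)[OF I] openin_nonzero by blast
        show "\<exists>U\<in>?nz ` I. p \<in> U" if "p \<in> A" for p
        proof -
          have "p \<in> topspace (stone_cech X)" "ext X h p \<noteq> 0"
            using that \<open>e > 0\<close> by (auto simp: A_def)
          then show ?thesis
            using h0[of p] by (auto simp: mem_spec_iff)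
        qed
        show "U \<union> V \<in> ?nz ` I" if UV: "U \<in> ?nz ` I" "V \<in> ?nz ` I" for U V
        proof -
          obtain f g where fg: "f \<in> I" "g \<in> I" "U = ?nz f" "V = ?nz g"
            using UV by blast
          obtain k where "k \<in> I"
            "\<And>p. p \<in> topspace (stone_cech X) \<Longrightarrow> ext X k p \<noteq> 0 \<longleftrightarrow> ext X f p \<noteq> 0 \<or> ext X g p \<noteq> 0"
            by (rule closed_ideal_nonzero_Un[OF I fg(1,2)]) (rule that)
          then show ?thesis
            unfolding fg by (intro image_eqI[of _ _ k]) auto
        qed
      qed
      then obtain k where k: "k \<in> I" "\<And>p. p \<in> A \<Longrightarrow> ext X k p \<noteq> 0"
        by blast
      then have kc: "k \<in> carrier (CB X)"
        using closed_idealD(1)[OF I] by blast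
      note kcont = continuous_map_ext[OF kc]
      obtain d where d: "d > 0" "\<And>p. p \<in> A \<Longrightarrow> d \<le> norm (ext X k p)"
      proof (cases "A = {}")
        case False
        have "compact ((\<lambda>p. norm (ext X k p)) ` A)"
          using image_compactin[OF A continuous_map_norm[OF kcont]] by simp
        then obtain m where "m \<in> (\<lambda>p. norm (ext X k p)) ` A"
          "\<And>t. t \<in> (\<lambda>p. norm (ext X k p)) ` A \<Longrightarrow> m \<le> t"
          using compact_attains_inf False by (metis image_is_empty)
        then show ?thesis
          using k(2) by (intro that[of m]) auto
      qed (use that[of 1] in auto)
      \<comment> \<open>Cutting the denominator off below at \<open>d\<^sup>2\<close> makes the multiplier \<open>q\<close> continuous on all of
        \<open>K\<close>, while \<open>k q = |k|\<^sup>2 / M\<close> still equals \<open>1\<close> on \<open>A\<close>, where \<open>|k| \<ge> d\<close>.\<close>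
      define M where "M = (\<lambda>p. max ((norm (ext X k p))\<^sup>2) (d\<^sup>2))"
      have M: "M p > 0" for p
        using d(1) by (simp add: M_def less_max_iff_disj)
      have "continuous_map (stone_cech X) euclideanreal M"
        unfolding M_def
        by (intro continuous_map_real_max continuous_map_real_pow continuous_map_norm kcont) auto
      then have "continuous_map (stone_cech X) euclideanreal (\<lambda>p. inverse (M p))"
        by (rule continuous_map_real_inverse) (rule less_imp_neq[OF M, symmetric])
      then have "continuous_map (stone_cech X) euclidean
          (\<lambda>p. cnj_field (ext X k p) * of_real (inverse (M p)))"
        by (intro continuous_map_mult_field continuous_map_cnj_field kcont
            continuous_map_of_real_comp)
      then obtain q where q: "q \<in> carrier (CB X)" "\<And>p. p \<in> topspace (stone_cech X) \<Longrightarrow>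
          ext X q p = cnj_field (ext X k p) * of_real (inverse (M p))"
        by (rule ext_surj) (rule that)
      define g where "g = h \<otimes>\<^bsub>CB X\<^esub> (k \<otimes>\<^bsub>CB X\<^esub> q)"
      have "g \<in> I"
        unfolding g_def using k(1) h q(1) by (intro closed_idealD[OF I])
      moreover have "dist (h x) (g x) \<le> e" if x: "x \<in> topspace X" for x
      proof -
        define p where "p = stone_cech_embed X x"
        have p: "p \<in> topspace (stone_cech X)"
          unfolding p_def using x by (rule stone_cech_embed_in_stone_cech)
        define t where "t = (norm (ext X k p))\<^sup>2 / M p"
        have t: "0 \<le> t" "t \<le> 1"
          using M[of p] by (auto simp: t_def field_simps) (simp add: M_def)
        have "ext X k p * ext X q p = of_real t"
          using q(2)[OF p]
          by (simp add: t_def mult_cnj_field divide_inverse flip: mult.assoc)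
        then have "ext X g p = ext X h p * of_real t"
          using h kc q(1) p by (simp add: g_def ext_mult CB_closed)
        then have "dist (ext X h p) (ext X g p) = norm (ext X h p * (1 - of_real t))"
          by (simp add: dist_norm algebra_simps)
        also have "\<dots> = norm (ext X h p) * (1 - t)"
        proof -
          have "1 - of_real t = (of_real (1 - t) :: 'f)"
            by simp
          then show ?thesis
            using t by (simp only: norm_mult norm_of_real)
        qed
        also have "\<dots> \<le> e"
        proof (cases "p \<in> A")
          case True
          then have "d\<^sup>2 \<le> (norm (ext X k p))\<^sup>2"
            using d by (intro power_mono) auto
          then have "t = 1"
            using M[of p] by (simp add: t_def M_def max_def)
          then show ?thesis
            using \<open>e > 0\<close> by simp
        next
          case False
          then have "norm (ext X h p) < e"
            using p by (simp add: A_def)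
          then show ?thesis
            using t mult_left_le[of "1 - t" "norm (ext X h p)"] by simp
        qed
        finally show ?thesis
          using x h closed_idealD(1)[OF I] \<open>g \<in> I\<close> by (auto simp: p_def ext_embed subset_eq)
      qed
      ultimately show "\<exists>g\<in>I. \<forall>x\<in>topspace X. dist (h x) (g x) \<le> e"
        by blast
    qed
  qed
qed

lemma normal_space_stone_cech: "normal_space (stone_cech X)"
  by (simp add: compact_Hausdorff_or_regular_imp_normal_space compact_space_stone_cech
      Hausdorff_space_stone_cech)

lemma closedin_stone_cech_singleton:
  "p \<in> topspace (stone_cech X) \<Longrightarrow> closedin (stone_cech X) {p}"
  by (simp add: Hausdorff_space_stone_cech closedin_Hausdorff_singleton)

lemma Urysohn_at_point:
  assumes W: "openin (stone_cech X) W" and p: "p \<in> W"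
  obtains u where "continuous_map (stone_cech X) euclideanreal u" "u p = 1"
    "\<And>q. q \<in> topspace (stone_cech X) - W \<Longrightarrow> u q = 0"
proof -
  have "p \<in> topspace (stone_cech X)"
    using openin_subset[OF W] p by blast
  then obtain u where u: "continuous_map (stone_cech X) euclideanreal u"
    "u ` {p} \<subseteq> {1}" "u ` (topspace (stone_cech X) - W) \<subseteq> {0}"
    using Urysohn_lemma_alt[OF normal_space_stone_cech closedin_stone_cech_singleton, of p X
        "topspace (stone_cech X) - W" 1 0] W p by (auto simp: disjnt_iff)
  show ?thesis
    by (rule that[OF u(1)]) (use u in auto)
qed

text \<open>
  Urysohn functions show that an open set is large enough to be seen by the functions it carries.
  Together with \<open>closed_ideal_eq_carried_by\<close> this makes closed ideals and open subsets of \<open>K\<close>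
  correspond bijectively.
\<close>
lemma spec_carried_by:
  assumes W: "openin (stone_cech X) W"
  shows "spec X (carried_by X W :: ('a \<Rightarrow> 'f::{euclidean_space,real_normed_field}) set) = W"
proof
  show "spec X (carried_by X W :: ('a \<Rightarrow> 'f) set) \<subseteq> W"
    by (auto simp: mem_spec_iff carried_by_def)
next
  show "W \<subseteq> spec X (carried_by X W :: ('a \<Rightarrow> 'f) set)"
  proof
    fix p assume p: "p \<in> W"
    then have pK: "p \<in> topspace (stone_cech X)"
      using openin_subset[OF W] by blast
    obtain u where u: "continuous_map (stone_cech X) euclideanreal u" "u p = 1"
      "\<And>q. q \<in> topspace (stone_cech X) - W \<Longrightarrow> u q = 0"
      using Urysohn_at_point[OF W p] by metis
    obtain f :: "'a \<Rightarrow> 'f" where f: "f \<in> carrier (CB X)"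
      "\<And>q. q \<in> topspace (stone_cech X) \<Longrightarrow> ext X f q = of_real (u q)"
      using ext_surj[OF continuous_map_of_real_comp[OF u(1)]] by metis
    have "f \<in> carried_by X W"
      using f u(3) by (simp add: carried_by_def)
    moreover have "ext X f p \<noteq> 0"
      using f(2)[OF pK] u(2) by simp
    ultimately show "p \<in> spec X (carried_by X W :: ('a \<Rightarrow> 'f) set)"
      using pK by (auto simp: mem_spec_iff)
  qed
qed

lemma carried_by_mono: "V \<subseteq> W \<Longrightarrow> carried_by X V \<subseteq> carried_by X W"
  by (auto simp: carried_by_def)

lemma closed_ideal_subset_iff:
  fixes I J :: "('a \<Rightarrow> 'f::{euclidean_space,real_normed_field}) set"
  assumes "closed_ideal X I" "closed_ideal X J"
  shows "I \<subseteq> J \<longleftrightarrow> spec X I \<subseteq> spec X J"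
proof
  show "I \<subseteq> J \<Longrightarrow> spec X I \<subseteq> spec X J"
    by (rule spec_mono)
  assume "spec X I \<subseteq> spec X J"
  then have "(carried_by X (spec X I) :: ('a \<Rightarrow> 'f) set) \<subseteq> carried_by X (spec X J)"
    by (rule carried_by_mono)
  then show "I \<subseteq> J"
    by (simp add: closed_ideal_eq_carried_by assms)
qed

section \<open>Direct sums and clopen partitions\<close>

text \<open>
  The summands are \<open>h\<close> cut off to \<open>U\<close> and to \<open>V\<close>. The cut-off is continuous because a boundary point
  of one of the two open sets lies in neither of them, and there \<open>h\<close> vanishes.
\<close>
lemma carried_by_decompose:
  fixes h :: "'a \<Rightarrow> 'f::{euclidean_space,real_normed_field}"
  assumes U: "openin (stone_cech X) U" and V: "openin (stone_cech X) V" and "U \<inter> V = {}"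
    and h: "h \<in> carried_by X (U \<union> V)"
  obtains f g where "f \<in> carried_by X U" "g \<in> carried_by X V" "h = f \<oplus>\<^bsub>CB X\<^esub> g"
proof -
  have hc: "h \<in> carrier (CB X)"
    and h0: "\<And>p. p \<in> topspace (stone_cech X) \<Longrightarrow> p \<notin> U \<Longrightarrow> p \<notin> V \<Longrightarrow> ext X h p = 0"
    using h by (auto simp: carried_by_def)
  have part: "\<exists>f\<in>carrier (CB X). \<forall>p\<in>topspace (stone_cech X).
      ext X f p = (if p \<in> A then ext X h p else 0)"
    if "openin (stone_cech X) A" "openin (stone_cech X) B" "A \<inter> B = {}" "A \<union> B = U \<union> V" for A B
  proof -
    have "continuous_map (stone_cech X) euclidean (\<lambda>p. if p \<in> A then ext X h p else 0)"
    proof (rule continuous_map_cases)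
      fix p assume "p \<in> stone_cech X frontier_of {p. p \<in> A}"
      then have p: "p \<in> stone_cech X closure_of A" "p \<notin> A"
        using that(1) by (auto simp: frontier_of_def interior_of_openin)
      then have "p \<notin> B"
        using that(2,3) openin_Int_closure_of_eq_empty[of "stone_cech X" B A] by blast
      with p that(4) show "ext X h p = 0"
        by (intro h0) (auto simp: in_closure_of)
    qed (auto intro: continuous_map_from_subtopology continuous_map_ext hc)
    then show ?thesis
      by (rule ext_surj) blast
  qed
  obtain f where f: "f \<in> carrier (CB X)"
    "\<And>p. p \<in> topspace (stone_cech X) \<Longrightarrow> ext X f p = (if p \<in> U then ext X h p else 0)"
    using part[of U V] assms(1-3) by blast
  obtain g where g: "g \<in> carrier (CB X)"
    "\<And>p. p \<in> topspace (stone_cech X) \<Longrightarrow> ext X g p = (if p \<in> V then ext X h p else 0)"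
    using part[of V U] assms(1-3) by blast
  show ?thesis
  proof
    show "f \<in> carried_by X U" "g \<in> carried_by X V"
      using f g by (auto simp: carried_by_def)
    show "h = f \<oplus>\<^bsub>CB X\<^esub> g"
      using f g hc h0 \<open>U \<inter> V = {}\<close>
      by (intro ext_inject[of _ X]) (auto simp: CB_closed ext_add)
  qed
qed

text \<open>
  If the sum is direct, products of members of \<open>I\<close> and \<open>J\<close> lie in the intersection and so are zero;
  hence no point lies in both spectra. Conversely, a partition of the spectrum lets every
  member of \<open>H\<close> be cut in two.
\<close>
theorem internal_direct_sum_iff_spec:
  fixes H :: "('a \<Rightarrow> 'f::{euclidean_space,real_normed_field}) set"
  assumes H: "closed_ideal X H" and I: "closed_ideal X I" and J: "closed_ideal X J"
  shows "internal_direct_sum (CB X) H I J \<longleftrightarrow>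
    spec X I \<inter> spec X J = {} \<and> spec X I \<union> spec X J = spec X H"
proof
  interpret cring "CB X :: ('a \<Rightarrow> 'f) ring" by (rule cring_CB)
  note sub = closed_idealD(1)[OF I] closed_idealD(1)[OF J]
  assume "internal_direct_sum (CB X) H I J"
  then have sum: "H = I <+>\<^bsub>CB X\<^esub> J" and int: "I \<inter> J = {\<zero>\<^bsub>CB X\<^esub>}"
    by (auto simp: internal_direct_sum_def)
  have "spec X I \<inter> spec X J = {}"
  proof (rule ccontr)
    assume "spec X I \<inter> spec X J \<noteq> {}"
    then obtain p f g where p: "p \<in> topspace (stone_cech X)"
      and fg: "f \<in> I" "g \<in> J" "ext X f p \<noteq> 0" "ext X g p \<noteq> 0"
      by (auto simp: mem_spec_iff)
    then have "f \<otimes>\<^bsub>CB X\<^esub> g \<in> I \<inter> J"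
      using sub closed_idealD(5)[OF I] closed_idealD(4)[OF J] by blast
    then have "f \<otimes>\<^bsub>CB X\<^esub> g = \<zero>\<^bsub>CB X\<^esub>"
      using int by blast
    moreover have "f \<in> carrier (CB X)" "g \<in> carrier (CB X)"
      using fg sub by blast+
    ultimately have "ext X f p * ext X g p = 0"
      using ext_mult[of f X g p] p by (simp add: ext_zero)
    with fg show False by simp
  qed
  moreover have "I \<subseteq> H" "J \<subseteq> H"
  proof -
    show "I \<subseteq> H"
      unfolding sum set_add_def' using sub closed_idealD(2)[OF J] by force
    show "J \<subseteq> H"
      unfolding sum set_add_def' using sub closed_idealD(2)[OF I] by force
  qed
  moreover have "spec X H \<subseteq> spec X I \<union> spec X J"
  proof
    fix p assume "p \<in> spec X H"
    then obtain h where p: "p \<in> topspace (stone_cech X)" and h: "h \<in> H" "ext X h p \<noteq> 0"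
      by (auto simp: mem_spec_iff)
    then obtain f g where "f \<in> I" "g \<in> J" "h = f \<oplus>\<^bsub>CB X\<^esub> g"
      unfolding sum set_add_def' by auto
    moreover from this have "f \<in> carrier (CB X)" "g \<in> carrier (CB X)"
      using sub by blast+
    ultimately have "ext X f p + ext X g p \<noteq> 0" "f \<in> I" "g \<in> J"
      using h(2) p by (simp_all add: ext_add)
    then show "p \<in> spec X I \<union> spec X J"
      using p by (auto simp: mem_spec_iff)
  qed
  ultimately show "spec X I \<inter> spec X J = {} \<and> spec X I \<union> spec X J = spec X H"
    by (auto dest: spec_mono[of _ _ X])
next
  assume spec: "spec X I \<inter> spec X J = {} \<and> spec X I \<union> spec X J = spec X H"
  then have "I \<subseteq> H" "J \<subseteq> H"
    unfolding closed_ideal_subset_iff[OF I H] closed_ideal_subset_iff[OF J H] by blast+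
  have "H = I <+>\<^bsub>CB X\<^esub> J"
  proof
    show "I <+>\<^bsub>CB X\<^esub> J \<subseteq> H"
      using \<open>I \<subseteq> H\<close> \<open>J \<subseteq> H\<close> closed_idealD(3)[OF H] by (auto simp: set_add_def')
    show "H \<subseteq> I <+>\<^bsub>CB X\<^esub> J"
    proof
      fix h assume "h \<in> H"
      then have "h \<in> carried_by X (spec X I \<union> spec X J)"
        using spec closed_ideal_eq_carried_by[OF H] by simp
      then obtain f g where "f \<in> carried_by X (spec X I)" "g \<in> carried_by X (spec X J)"
        "h = f \<oplus>\<^bsub>CB X\<^esub> g"
        using carried_by_decompose[OF openin_spec openin_spec] spec closed_idealD(1) I J by metis
      then show "h \<in> I <+>\<^bsub>CB X\<^esub> J"
        unfolding closed_ideal_eq_carried_by[OF I] closed_ideal_eq_carried_by[OF J]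
        by (auto simp: set_add_def')
    qed
  qed
  moreover have "I \<inter> J = {\<zero>\<^bsub>CB X\<^esub>}"
  proof -
    have "f = \<zero>\<^bsub>CB X\<^esub>" if f: "f \<in> I" "f \<in> J" for f
    proof (rule ext_inject)
      show "f \<in> carrier (CB X)"
        using f closed_idealD(1)[OF I] by blast
      fix p assume p: "p \<in> topspace (stone_cech X)"
      have "ext X f p = 0"
        using f spec p by (auto simp: mem_spec_iff disjoint_iff)
      then show "ext X f p = ext X \<zero>\<^bsub>CB X\<^esub> p"
        using p by (simp add: ext_zero)
    qed (rule CB_closed)
    then show ?thesis
      using closed_idealD(2)[OF I] closed_idealD(2)[OF J] by blast
  qed
  ultimately show "internal_direct_sum (CB X) H I J"
    by (simp add: internal_direct_sum_def)
qed

section \<open>Maximal closed subideals\<close>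

lemma openin_spec_minus_point:
  assumes "closed_ideal X H" "x \<in> spec X H"
  shows "openin (stone_cech X) (spec X H - {x})"
proof -
  have "x \<in> topspace (stone_cech X)"
    using assms(2) by (simp add: mem_spec_iff)
  then show ?thesis
    using openin_spec closed_idealD(1)[OF assms(1)] closedin_stone_cech_singleton
    by (intro openin_diff) auto
qed

text \<open>
  Under the correspondence with open sets, a maximal closed subideal is a maximal proper open subset
  of the spectrum. Points of \<open>K\<close> are closed, so removing one point from the spectrum leaves an open
  set, and these sets are exactly the maximal ones.
\<close>
theorem maximal_closed_subideal_iff:
  assumes H: "closed_ideal X H"
  shows "maximal_closed_subideal X H M \<longleftrightarrow> (\<exists>x\<in>spec X H. M = carried_by X (spec X H - {x}))"
proof
  assume M: "maximal_closed_subideal X H M"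
  then have cM: "closed_ideal X M" and sub: "M \<subseteq> H" "M \<noteq> H"
    and max: "\<And>I. closed_ideal X I \<Longrightarrow> I \<subseteq> H \<Longrightarrow> M \<subseteq> I \<Longrightarrow> I = M \<or> I = H"
    by (auto simp: maximal_closed_subideal_def closed_subideal_def)
  then obtain x where x: "x \<in> spec X H" "x \<notin> spec X M"
    using closed_ideal_subset_iff[OF H cM] by blast
  define I where "I = (carried_by X (spec X H - {x}) :: ('a \<Rightarrow> 'b) set)"
  have I: "closed_ideal X I"
    unfolding I_def by (rule closed_ideal_carried_by)
  have spec_I: "spec X I = spec X H - {x}"
    unfolding I_def by (rule spec_carried_by[OF openin_spec_minus_point[OF H x(1)]])
  have "M \<subseteq> I" "I \<subseteq> H"
    using spec_mono[OF sub(1), of X] x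
    unfolding closed_ideal_subset_iff[OF cM I] closed_ideal_subset_iff[OF I H] spec_I by blast+
  moreover have "I \<noteq> H"
    using spec_I x(1) by auto
  ultimately have "I = M"
    using max[OF I] by blast
  then show "\<exists>x\<in>spec X H. M = carried_by X (spec X H - {x})"
    using x(1) I_def by blast
next
  assume "\<exists>x\<in>spec X H. M = carried_by X (spec X H - {x})"
  then obtain x where x: "x \<in> spec X H" and M: "M = carried_by X (spec X H - {x})"
    by blast
  have cM: "closed_ideal X M"
    unfolding M by (rule closed_ideal_carried_by)
  have spec_M: "spec X M = spec X H - {x}"
    unfolding M by (rule spec_carried_by[OF openin_spec_minus_point[OF H x]])
  have "I = M \<or> I = H" if I: "closed_ideal X I" "I \<subseteq> H" "M \<subseteq> I" for I
  proof -
    have "spec X H - {x} \<subseteq> spec X I" "spec X I \<subseteq> spec X H"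
      using spec_mono[OF I(2), of X] spec_mono[OF I(3), of X] unfolding spec_M by blast+
    then have "spec X I = spec X M \<or> spec X I = spec X H"
      using spec_M by blast
    then show ?thesis
      using closed_ideal_eq_carried_by I(1) cM H by metis
  qed
  moreover have "M \<subseteq> H"
    by (simp add: closed_ideal_subset_iff[OF cM H] spec_M)
  moreover have "M \<noteq> H"
    using spec_M x by auto
  ultimately show "maximal_closed_subideal X H M"
    using cM by (auto simp: maximal_closed_subideal_def closed_subideal_def)
qed

section \<open>Separated elements\<close>

text \<open>
  If \<open>l\<close> stabilizes \<open>f\<close> and \<open>k\<close> annihilates \<open>f\<close>, then \<open>l = 1\<close> and \<open>k = 0\<close> wherever \<open>f\<close> is nonzero.
  The set of points with \<open>l = 1\<close> and \<open>k = 0\<close> is closed in \<open>K\<close>, and it lies in the spectrum since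
  \<open>l \<in> H\<close>. Exchanging \<open>k\<close> and \<open>l\<close> gives the set for \<open>g\<close>; the two are disjoint because \<open>l\<close> cannot be
  both \<open>1\<close> and \<open>0\<close>.
\<close>
lemma separated_in_closed_supports:
  assumes H: "H \<subseteq> carrier (CB X)" and fg: "f \<in> H" "g \<in> H" and sep: "separated_in X H f g"
  obtains C D where "closedin (stone_cech X) C" "closedin (stone_cech X) D"
    "C \<inter> D = {}" "C \<subseteq> spec X H" "D \<subseteq> spec X H" "f \<in> carried_by X C" "g \<in> carried_by X D"
proof -
  obtain k l where kl: "k \<in> H" "l \<in> H"
    and eqs: "k \<otimes>\<^bsub>CB X\<^esub> f = \<zero>\<^bsub>CB X\<^esub>" "k \<otimes>\<^bsub>CB X\<^esub> g = g" "l \<otimes>\<^bsub>CB X\<^esub> g = \<zero>\<^bsub>CB X\<^esub>" "l \<otimes>\<^bsub>CB X\<^esub> f = f"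
    using sep by (auto simp: separated_in_def Ann_def Stab_def)
  have carrier: "f \<in> carrier (CB X)" "g \<in> carrier (CB X)" "k \<in> carrier (CB X)" "l \<in> carrier (CB X)"
    using H fg kl by auto
  define level where "level m n = {p \<in> topspace (stone_cech X). ext X m p \<in> {1}} \<inter>
    {p \<in> topspace (stone_cech X). ext X n p \<in> {0}}" for m n :: "'a \<Rightarrow> 'b"
  have closed: "closedin (stone_cech X) (level m n)"
    if "m \<in> carrier (CB X)" "n \<in> carrier (CB X)" for m n
    unfolding level_def
    by (intro closedin_Int closedin_continuous_map_preimage[OF continuous_map_ext] that) auto
  have carried: "u \<in> carried_by X (level m n)"
    if "u \<in> carrier (CB X)" "m \<in> carrier (CB X)" "n \<in> carrier (CB X)"
      "m \<otimes>\<^bsub>CB X\<^esub> u = u" "n \<otimes>\<^bsub>CB X\<^esub> u = \<zero>\<^bsub>CB X\<^esub>" for u m n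
  proof -
    have "p \<in> level m n" if p: "p \<in> topspace (stone_cech X)" "ext X u p \<noteq> 0" for p
    proof -
      have "ext X m p * ext X u p = ext X u p" "ext X n p * ext X u p = 0"
        using that \<open>u \<in> carrier (CB X)\<close> \<open>m \<in> carrier (CB X)\<close> \<open>n \<in> carrier (CB X)\<close>
          \<open>m \<otimes>\<^bsub>CB X\<^esub> u = u\<close> \<open>n \<otimes>\<^bsub>CB X\<^esub> u = \<zero>\<^bsub>CB X\<^esub>\<close> ext_mult[of _ X u p] ext_zero[of p X] by metis+
      then show ?thesis
        using p by (simp add: level_def)
    qed
    then show ?thesis
      using that(1) by (auto simp: carried_by_def)
  qed
  show ?thesis
  proof
    show "closedin (stone_cech X) (level l k)" "closedin (stone_cech X) (level k l)"
      using carrier closed by auto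
    show "f \<in> carried_by X (level l k)" "g \<in> carried_by X (level k l)"
      using carrier eqs carried by auto
    show "level l k \<inter> level k l = {}"
      by (auto simp: level_def)
    show "level l k \<subseteq> spec X H" "level k l \<subseteq> spec X H"
      using kl by (force simp: level_def mem_spec_iff)+
  qed
qed

text \<open>
  All four functions involved are obtained from one continuous real function \<open>a\<close> on \<open>K\<close> with
  \<open>a x = 1\<close> and \<open>a y = -1\<close> that vanishes off the spectrum, by composing with piecewise linear functions
  that vanish at \<open>0\<close>. The function \<open>f\<close> lives where \<open>a > 2/3\<close>, and its stabilizer \<open>l\<close> is \<open>1\<close> there
  and \<open>0\<close> where \<open>a \<le> 1/3\<close>; \<open>g\<close> and \<open>k\<close> are the mirror images for \<open>-a\<close>.
\<close>
lemma separated_in_at_points: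
  fixes H :: "('a \<Rightarrow> 'f::{euclidean_space,real_normed_field}) set"
  assumes H: "closed_ideal X H" and x: "x \<in> spec X H" and y: "y \<in> spec X H" and "x \<noteq> y"
  obtains f g where "f \<in> H" "g \<in> H" "separated_in X H f g" "ext X f x \<noteq> 0" "ext X g y \<noteq> 0"
proof -
  let ?K = "topspace (stone_cech X)"
  have xy: "x \<in> ?K" "y \<in> ?K"
    using x y by (auto simp: mem_spec_iff)
  obtain u where u: "continuous_map (stone_cech X) euclideanreal u" "u x = 1"
    "\<And>q. q \<in> ?K - (spec X H - {y}) \<Longrightarrow> u q = 0"
    using Urysohn_at_point[OF openin_spec_minus_point[OF H y], of x] x \<open>x \<noteq> y\<close> by auto
  obtain v where v: "continuous_map (stone_cech X) euclideanreal v" "v y = 1"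
    "\<And>q. q \<in> ?K - (spec X H - {x}) \<Longrightarrow> v q = 0"
    using Urysohn_at_point[OF openin_spec_minus_point[OF H x], of y] y \<open>x \<noteq> y\<close> by auto
  define a where "a = (\<lambda>p. u p - v p)"
  have a: "continuous_map (stone_cech X) euclideanreal a" "a x = 1" "a y = - 1"
    unfolding a_def using u v xy by (auto intro!: continuous_map_diff)
  have a0: "a q = 0" if "q \<in> ?K" "q \<notin> spec X H" for q
    using that u(3)[of q] v(3)[of q] by (simp add: a_def)
  have lift: "\<exists>h\<in>H. \<forall>p\<in>?K. ext X h p = of_real (\<phi> (a p))"
    if \<phi>: "continuous_on UNIV \<phi>" "\<phi> 0 = 0" for \<phi> :: "real \<Rightarrow> real"
  proof -
    have "continuous_map (stone_cech X) euclideanreal (\<lambda>p. \<phi> (a p))"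
      using continuous_map_compose[OF a(1), of euclideanreal \<phi>] \<phi>(1) by (simp add: o_def)
    then obtain h :: "'a \<Rightarrow> 'f" where h: "h \<in> carrier (CB X)"
      "\<And>p. p \<in> ?K \<Longrightarrow> ext X h p = of_real (\<phi> (a p))"
      using ext_surj[OF continuous_map_of_real_comp] by metis
    then have "h \<in> carried_by X (spec X H)"
      using a0 \<phi>(2) by (simp add: carried_by_def)
    then show ?thesis
      using h closed_ideal_eq_carried_by[OF H] by auto
  qed
  have cont: "continuous_on UNIV (\<lambda>t::real. max 0 (t - 2/3))"
    "continuous_on UNIV (\<lambda>t::real. max 0 (- t - 2/3))"
    "continuous_on UNIV (\<lambda>t::real. min 1 (max 0 (3 * t - 1)))"
    "continuous_on UNIV (\<lambda>t::real. min 1 (max 0 (- 3 * t - 1)))"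
    by (intro continuous_intros)+
  obtain f where f: "f \<in> H" "\<And>p. p \<in> ?K \<Longrightarrow> ext X f p = of_real (max 0 (a p - 2/3))"
    using lift[OF cont(1)] by auto
  obtain g where g: "g \<in> H" "\<And>p. p \<in> ?K \<Longrightarrow> ext X g p = of_real (max 0 (- a p - 2/3))"
    using lift[OF cont(2)] by auto
  obtain l where l: "l \<in> H" "\<And>p. p \<in> ?K \<Longrightarrow> ext X l p = of_real (min 1 (max 0 (3 * a p - 1)))"
    using lift[OF cont(3)] by auto
  obtain k where k: "k \<in> H" "\<And>p. p \<in> ?K \<Longrightarrow> ext X k p = of_real (min 1 (max 0 (- 3 * a p - 1)))"
    using lift[OF cont(4)] by auto
  have carrier: "f \<in> carrier (CB X)" "g \<in> carrier (CB X)" "k \<in> carrier (CB X)" "l \<in> carrier (CB X)"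
    using f g k l closed_idealD(1)[OF H] by auto
  have "k \<in> Ann X f" "l \<in> Ann X g" "k \<in> Stab X g" "l \<in> Stab X f"
    unfolding Ann_def Stab_def using carrier
    by (auto intro!: ext_inject[of _ X] CB_closed(1) CB_closed(3) simp: ext_mult ext_zero f g k l
        max_def min_def)
  then have "separated_in X H f g"
    using k(1) l(1) by (auto simp: separated_in_def)
  moreover have "ext X f x = of_real (1/3)" "ext X g y = of_real (1/3)"
    using f(2)[OF xy(1)] g(2)[OF xy(2)] a by simp_all
  then have "ext X f x \<noteq> 0" "ext X g y \<noteq> 0"
    by (simp_all only: of_real_eq_0_iff)
  ultimately show ?thesis
    using f(1) g(1) by (intro that)
qed

section \<open>Totally separated spectra\<close>

lemma completely_regular_Hausdorff_spectrum:
  "completely_regular_space (spectrum X H)" "Hausdorff_space (spectrum X H)"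
  unfolding spectrum_def
  by (auto intro!: completely_regular_space_subtopology Hausdorff_space_subtopology
      normal_imp_completely_regular_space normal_space_stone_cech Hausdorff_space_stone_cech)

lemma openin_spectrum_iff:
  assumes "H \<subseteq> carrier (CB X)"
  shows "openin (spectrum X H) U \<longleftrightarrow> openin (stone_cech X) U \<and> U \<subseteq> spec X H"
  using openin_open_subtopology[OF openin_spec[OF assms]] spectrum_eq[of X H] by metis

text \<open>
  The spectrum is open in \<open>K\<close>, so a clopen subset of it together with its complement is just a
  partition of the spectrum into two open subsets of \<open>K\<close>. This is the form in which direct sums
  produce clopen sets.
\<close>
lemma totally_separated_spectrum_iff:
  assumes H: "H \<subseteq> carrier (CB X)"
  shows "totally_separated_space (spectrum X H) \<longleftrightarrow>
    (\<forall>x\<in>spec X H. \<forall>y\<in>spec X H. x \<noteq> y \<longrightarrow>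
      (\<exists>U V. openin (stone_cech X) U \<and> openin (stone_cech X) V \<and>
        U \<inter> V = {} \<and> U \<union> V = spec X H \<and> x \<in> U \<and> y \<in> V))" (is "?ts \<longleftrightarrow> ?part")
proof
  assume ?ts
  show ?part
  proof (intro ballI impI)
    fix x y assume xy: "x \<in> spec X H" "y \<in> spec X H" "x \<noteq> y"
    then obtain U V where UV: "openin (spectrum X H) U" "closedin (spectrum X H) U"
      "disjnt U V" "x \<in> U" "y \<in> V"
      using \<open>?ts\<close> unfolding totally_separated_space_def by blast
    then have "openin (spectrum X H) (spec X H - U)" "y \<in> spec X H - U" "U \<subseteq> spec X H"
      using xy by (auto simp: closedin_def disjnt_iff)
    with UV show "\<exists>U V. openin (stone_cech X) U \<and> openin (stone_cech X) V \<and>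
        U \<inter> V = {} \<and> U \<union> V = spec X H \<and> x \<in> U \<and> y \<in> V"
      by (intro exI[of _ U] exI[of _ "spec X H - U"]) (auto simp: openin_spectrum_iff H)
  qed
next
  assume ?part
  have "\<exists>U V. openin (spectrum X H) U \<and> closedin (spectrum X H) U \<and>
      openin (spectrum X H) V \<and> closedin (spectrum X H) V \<and> disjnt U V \<and> x \<in> U \<and> y \<in> V"
    if xy: "x \<in> spec X H" "y \<in> spec X H" "x \<noteq> y" for x y
  proof -
    obtain U V where UV: "openin (stone_cech X) U" "openin (stone_cech X) V"
      "U \<inter> V = {}" "U \<union> V = spec X H" "x \<in> U" "y \<in> V"
      using \<open>?part\<close>[rule_format, OF xy] by (elim exE conjE)
    then have op: "openin (spectrum X H) U" "openin (spectrum X H) V"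
      by (auto simp: openin_spectrum_iff H)
    have "spec X H - U = V" "spec X H - V = U"
      using UV by blast+
    then have "closedin (spectrum X H) U" "closedin (spectrum X H) V"
      unfolding closedin_def using op UV(4) by auto
    with op UV show ?thesis
      by (auto simp: disjnt_def)
  qed
  then show ?ts
    unfolding totally_separated_space_def
    by (intro conjI ballI impI completely_regular_Hausdorff_spectrum)
qed

text \<open>
  Compactness is used twice: first to separate a point of \<open>C\<close> from all of \<open>D\<close>, by covering \<open>D\<close> with
  clopen sets that miss the point; then to cover \<open>C\<close> with clopen sets that miss \<open>D\<close>.
\<close>
lemma totally_separated_compact_sets:
  assumes Y: "totally_separated_space Y" and C: "compactin Y C" and D: "compactin Y D"
    and disj: "C \<inter> D = {}"
  obtains U where "openin Y U" "closedin Y U" "C \<subseteq> U" "U \<inter> D = {}"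
proof -
  have point: "\<exists>U. (openin Y U \<and> closedin Y U \<and> U \<inter> D = {}) \<and> c \<in> U" if c: "c \<in> C" for c
  proof -
    have cY: "c \<in> topspace Y"
      using c compactin_subset_topspace[OF C] by blast
    obtain V where V: "V \<in> {V. openin Y V \<and> closedin Y V \<and> c \<notin> V}" "D \<subseteq> V"
    proof (rule compactin_subset_directed_cover[OF D,
          of "{V. openin Y V \<and> closedin Y V \<and> c \<notin> V}"])
      fix d assume "d \<in> D"
      then have "d \<in> topspace Y" "c \<noteq> d"
        using compactin_subset_topspace[OF D] c disj by auto
      then obtain U V where "openin Y V" "closedin Y V" "disjnt U V" "c \<in> U" "d \<in> V"
        using Y cY unfolding totally_separated_space_def by meson
      then show "\<exists>V\<in>{V. openin Y V \<and> closedin Y V \<and> c \<notin> V}. d \<in> V"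
        by (auto simp: disjnt_iff)
    qed auto
    then show ?thesis
      using cY by (intro exI[of _ "topspace Y - V"]) auto
  qed
  obtain U where "U \<in> {U. openin Y U \<and> closedin Y U \<and> U \<inter> D = {}}" "C \<subseteq> U"
    by (rule compactin_subset_directed_cover[OF C,
          of "{U. openin Y U \<and> closedin Y U \<and> U \<inter> D = {}}"]) (use point in auto)
  then show ?thesis
    by (intro that) auto
qed

text \<open>
  Note the exchange of roles: a summand contained in the maximal subideal at \<open>x\<close> has a spectrum that
  avoids \<open>x\<close>, so \<open>x\<close> lies in the spectrum of the other summand.
\<close>
theorem totally_separated_iff_maximal_closed_subideals:
  fixes H :: "('a \<Rightarrow> 'f::{euclidean_space,real_normed_field}) set"
  assumes H: "closed_ideal X H"
  shows "totally_separated_space (spectrum X H) \<longleftrightarrow>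
    (\<forall>M N. maximal_closed_subideal X H M \<and> maximal_closed_subideal X H N \<and> M \<noteq> N \<longrightarrow>
      (\<exists>I J. closed_ideal X I \<and> closed_ideal X J \<and> I \<subseteq> M \<and> J \<subseteq> N \<and>
        internal_direct_sum (CB X) H I J))" (is "?ts \<longleftrightarrow> ?max")
proof
  assume ?ts
  show ?max
  proof (intro allI impI)
    fix M N :: "('a \<Rightarrow> 'f) set"
    assume "maximal_closed_subideal X H M \<and> maximal_closed_subideal X H N \<and> M \<noteq> N"
    then obtain x y where xy: "x \<in> spec X H" "y \<in> spec X H" "x \<noteq> y"
      and MN: "M = carried_by X (spec X H - {x})" "N = carried_by X (spec X H - {y})"
      by (auto simp: maximal_closed_subideal_iff[OF H])
    obtain U V where UV: "openin (stone_cech X) U" "openin (stone_cech X) V"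
      "U \<inter> V = {}" "U \<union> V = spec X H" "x \<in> U" "y \<in> V"
      using \<open>?ts\<close> xy unfolding totally_separated_spectrum_iff[OF closed_idealD(1)[OF H]] by metis
    have "internal_direct_sum (CB X) H (carried_by X V) (carried_by X U)"
      using UV by (auto simp: internal_direct_sum_iff_spec H closed_ideal_carried_by spec_carried_by)
    moreover have "carried_by X V \<subseteq> M" "carried_by X U \<subseteq> N"
      unfolding MN using UV by (intro carried_by_mono; blast)+
    ultimately show "\<exists>I J. closed_ideal X I \<and> closed_ideal X J \<and> I \<subseteq> M \<and> J \<subseteq> N \<and>
        internal_direct_sum (CB X) H I J"
      using closed_ideal_carried_by by blast
  qed
next
  assume ?max
  show ?ts
    unfolding totally_separated_spectrum_iff[OF closed_idealD(1)[OF H]]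
  proof (intro ballI impI)
    fix x y assume xy: "x \<in> spec X H" "y \<in> spec X H" "x \<noteq> y"
    define M N :: "('a \<Rightarrow> 'f) set"
      where "M = carried_by X (spec X H - {x})" and "N = carried_by X (spec X H - {y})"
    have spec: "spec X M = spec X H - {x}" "spec X N = spec X H - {y}"
      unfolding M_def N_def using xy H by (auto simp: spec_carried_by openin_spec_minus_point)
    have "maximal_closed_subideal X H M" "maximal_closed_subideal X H N"
      using xy by (auto simp: maximal_closed_subideal_iff[OF H] M_def N_def)
    moreover have "M \<noteq> N"
      using spec xy by auto
    ultimately obtain I J where IJ: "closed_ideal X I" "closed_ideal X J" "I \<subseteq> M" "J \<subseteq> N"
      "internal_direct_sum (CB X) H I J"
      using \<open>?max\<close> by metis
    have avoid: "x \<notin> spec X I" "y \<notin> spec X J"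
      using spec_mono[OF IJ(3), of X] spec_mono[OF IJ(4), of X] unfolding spec by blast+
    have part: "spec X I \<inter> spec X J = {}" "spec X I \<union> spec X J = spec X H"
      using IJ(5) by (auto simp: internal_direct_sum_iff_spec H IJ(1,2))
    have open_IJ: "openin (stone_cech X) (spec X I)" "openin (stone_cech X) (spec X J)"
      using IJ(1,2) by (auto intro!: openin_spec closed_idealD(1))
    have "x \<in> spec X J" "y \<in> spec X I"
      using avoid xy(1,2) unfolding part(2)[symmetric] by blast+
    with part open_IJ show "\<exists>U V. openin (stone_cech X) U \<and> openin (stone_cech X) V \<and>
        U \<inter> V = {} \<and> U \<union> V = spec X H \<and> x \<in> U \<and> y \<in> V"
      by (intro exI[of _ "spec X J"] exI[of _ "spec X I"]) (simp add: Int_commute Un_commute)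
  qed
qed

theorem totally_separated_iff_separated_elements:
  fixes H :: "('a \<Rightarrow> 'f::{euclidean_space,real_normed_field}) set"
  assumes H: "closed_ideal X H"
  shows "totally_separated_space (spectrum X H) \<longleftrightarrow>
    (\<forall>f\<in>H. \<forall>g\<in>H. separated_in X H f g \<longrightarrow>
      (\<exists>F G. closed_ideal X F \<and> closed_ideal X G \<and> f \<in> F \<and> g \<in> G \<and>
        internal_direct_sum (CB X) H F G))" (is "?ts \<longleftrightarrow> ?sep")
proof
  note sub = closed_idealD(1)[OF H]
  assume ?ts
  show ?sep
  proof (intro ballI impI)
    fix f g assume fg: "f \<in> H" "g \<in> H" and "separated_in X H f g"
    then obtain C D where CD: "closedin (stone_cech X) C" "closedin (stone_cech X) D"
      "C \<inter> D = {}" "C \<subseteq> spec X H" "D \<subseteq> spec X H"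
      and carried: "f \<in> carried_by X C" "g \<in> carried_by X D"
      using separated_in_closed_supports[OF sub] by metis
    have "compactin (spectrum X H) C" "compactin (spectrum X H) D"
      using CD by (auto intro: compactin_spectrum)
    then obtain U where U: "openin (spectrum X H) U" "closedin (spectrum X H) U" "C \<subseteq> U" "U \<inter> D = {}"
      using totally_separated_compact_sets[OF \<open>?ts\<close>] CD(3) by metis
    define V where "V = spec X H - U"
    have UV: "openin (stone_cech X) U" "openin (stone_cech X) V" "U \<subseteq> spec X H"
      using U unfolding closedin_def V_def by (auto simp: openin_spectrum_iff[OF sub])
    have "internal_direct_sum (CB X) H (carried_by X U) (carried_by X V)"
      using UV by (auto simp: internal_direct_sum_iff_spec H closed_ideal_carried_by
          spec_carried_by V_def)
    moreover have "f \<in> carried_by X U" "g \<in> carried_by X V"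
      using carried carried_by_mono[of C U X] carried_by_mono[of D V X] U CD(5)
      by (auto simp: V_def)
    ultimately show "\<exists>F G. closed_ideal X F \<and> closed_ideal X G \<and> f \<in> F \<and> g \<in> G \<and>
        internal_direct_sum (CB X) H F G"
      using closed_ideal_carried_by by blast
  qed
next
  assume ?sep
  show ?ts
    unfolding totally_separated_spectrum_iff[OF closed_idealD(1)[OF H]]
  proof (intro ballI impI)
    fix x y assume xy: "x \<in> spec X H" "y \<in> spec X H" "x \<noteq> y"
    obtain f g where fg: "f \<in> H" "g \<in> H" "separated_in X H f g" "ext X f x \<noteq> 0" "ext X g y \<noteq> 0"
      using separated_in_at_points[OF H xy] by metis
    obtain F G where FG: "closed_ideal X F" "closed_ideal X G" "f \<in> F" "g \<in> G"
      "internal_direct_sum (CB X) H F G"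
      using \<open>?sep\<close> fg(1-3) by metis
    have "x \<in> spec X F" "y \<in> spec X G"
      using xy fg FG by (auto simp: mem_spec_iff)
    moreover have "spec X F \<inter> spec X G = {}" "spec X F \<union> spec X G = spec X H"
      using FG(5) by (auto simp: internal_direct_sum_iff_spec H FG(1,2))
    moreover have "openin (stone_cech X) (spec X F)" "openin (stone_cech X) (spec X G)"
      using FG(1,2) by (auto intro!: openin_spec closed_idealD(1))
    ultimately show "\<exists>U V. openin (stone_cech X) U \<and> openin (stone_cech X) V \<and>
        U \<inter> V = {} \<and> U \<union> V = spec X H \<and> x \<in> U \<and> y \<in> V"
      by blast
  qed
qed

theorem theorem4p10:
  fixes X :: "'a topology"
  assumes "completely_regular_space X" and "Hausdorff_space X"
  shows
    "(\<forall>H :: ('a \<Rightarrow> real) set. closed_ideal X H \<and> non_vanishing X H \<longrightarrow>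
        (totally_separated_space (spectrum X H) \<longleftrightarrow>
          (\<forall>M N. maximal_closed_subideal X H M \<and> maximal_closed_subideal X H N \<and> M \<noteq> N \<longrightarrow>
             (\<exists>I J. closed_ideal X I \<and> closed_ideal X J \<and> I \<subseteq> M \<and> J \<subseteq> N \<and>
                    internal_direct_sum (CB X) H I J))) \<and>
        (totally_separated_space (spectrum X H) \<longleftrightarrow>
          (\<forall>f\<in>H. \<forall>g\<in>H. separated_in X H f g \<longrightarrow>
             (\<exists>F G. closed_ideal X F \<and> closed_ideal X G \<and> f \<in> F \<and> g \<in> G \<and>
                    internal_direct_sum (CB X) H F G)))) \<and>
     (\<forall>H :: ('a \<Rightarrow> complex) set. closed_ideal X H \<and> non_vanishing X H \<longrightarrow>
        (totally_separated_space (spectrum X H) \<longleftrightarrow>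
          (\<forall>M N. maximal_closed_subideal X H M \<and> maximal_closed_subideal X H N \<and> M \<noteq> N \<longrightarrow>
             (\<exists>I J. closed_ideal X I \<and> closed_ideal X J \<and> I \<subseteq> M \<and> J \<subseteq> N \<and>
                    internal_direct_sum (CB X) H I J))) \<and>
        (totally_separated_space (spectrum X H) \<longleftrightarrow>
          (\<forall>f\<in>H. \<forall>g\<in>H. separated_in X H f g \<longrightarrow>
             (\<exists>F G. closed_ideal X F \<and> closed_ideal X G \<and> f \<in> F \<and> g \<in> G \<and>
                    internal_direct_sum (CB X) H F G))))"
  by (intro conjI allI impI totally_separated_iff_maximal_closed_subideals
      totally_separated_iff_separated_elements) simp_all

end
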